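(* Let $X_1,X_2,\ldots$ be independent random variables with $\mathsf{E}X_i=0$ and $0<\mathsf{E}X_i^2=\sigma_i^2<\infty$ for all $i\ge 1$. For $n\in\mathbb{N}$ put $S_n=X_1+\ldots+X_n$ and $B_n^2=\sigma_1^2+\ldots+\sigma_n^2$ ($B_n>0$). Then for any $n\in\mathbb{N}$ and any $\varepsilon>0$ $$\sup_{z\ge 0}\Big|Q_{S_n}(z)-\Phi_0\Big(\frac{z}{2B_n}\Big)\Big|\le 7.4508\,\big[L_n(\varepsilon)+M_n(\varepsilon)\big],$$ where $$L_n(\varepsilon)=\frac{1}{B_n^2}\sum_{i=1}^n\mathsf{E}X_i^2\,\mathbb{I}(|X_i|\ge\varepsilon B_n),\qquad M_n(\varepsilon)=\frac{1}{B_n^3}\sum_{i=1}^n\mathsf{E}|X_i|^3\,\mathbb{I}(|X_i|<\varepsilon B_n).$$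
   Context: The concentration function of a random variable $\xi$ is $Q_\xi(z)=\sup_{x\in\mathbb{R}}\mathsf{P}(x\le\xi\le x+z)$, $z\ge 0$. $\Phi$ is the standard normal distribution function, and the folded normal distribution function is $\Phi_0(x)=2\Phi(x)-1$ for $x\ge 0$, $\Phi_0(x)=0$ for $x<0$. $\mathbb{I}(A)$ is the indicator of the event $A$. *)

theory Defs
  imports "HOL-Probability.Probability"
begin

definition concentration_fun :: "'a measure \<Rightarrow> ('a \<Rightarrow> real) \<Rightarrow> real \<Rightarrow> real" where
  "concentration_fun M \<xi> z = (SUP x. measure M {\<omega> \<in> space M. x \<le> \<xi> \<omega> \<and> \<xi> \<omega> \<le> x + z})"

definition std_normal_cdf :: "real \<Rightarrow> real" where
  "std_normal_cdf = cdf std_normal_distribution"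

definition folded_normal_cdf :: "real \<Rightarrow> real" where
  "folded_normal_cdf x = (if x \<ge> 0 then 2 * std_normal_cdf x - 1 else 0)"

definition partial_sum :: "(nat \<Rightarrow> 'a \<Rightarrow> real) \<Rightarrow> nat \<Rightarrow> 'a \<Rightarrow> real" where
  "partial_sum X n \<omega> = (\<Sum>i=1..n. X i \<omega>)"

definition B_norm :: "(nat \<Rightarrow> real) \<Rightarrow> nat \<Rightarrow> real" where
  "B_norm \<sigma> n = sqrt (\<Sum>i=1..n. (\<sigma> i)\<^sup>2)"

definition L_frac ::
  "'a measure \<Rightarrow> (nat \<Rightarrow> 'a \<Rightarrow> real) \<Rightarrow> (nat \<Rightarrow> real) \<Rightarrow> nat \<Rightarrow> real \<Rightarrow> real" where
  "L_frac M X \<sigma> n \<epsilon> =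
     1 / (B_norm \<sigma> n)\<^sup>2 *
     (\<Sum>i=1..n. \<integral>\<omega>. (X i \<omega>)\<^sup>2 * indicator {\<omega>. \<bar>X i \<omega>\<bar> \<ge> \<epsilon> * B_norm \<sigma> n} \<omega> \<partial>M)"

definition M_frac ::
  "'a measure \<Rightarrow> (nat \<Rightarrow> 'a \<Rightarrow> real) \<Rightarrow> (nat \<Rightarrow> real) \<Rightarrow> nat \<Rightarrow> real \<Rightarrow> real" where
  "M_frac M X \<sigma> n \<epsilon> =
     1 / (B_norm \<sigma> n) ^ 3 *
     (\<Sum>i=1..n. \<integral>\<omega>. \<bar>X i \<omega>\<bar> ^ 3 * indicator {\<omega>. \<bar>X i \<omega>\<bar> < \<epsilon> * B_norm \<sigma> n} \<omega> \<partial>M)"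

text \<open>The suprema are taken in the type of real numbers, where a supremum is meaningful only for
  sets that are bounded above. The next three lemmas show that those used here are.\<close>

lemma (in prob_space) bdd_above_concentration_fun:
  "bdd_above (range (\<lambda>x. prob {\<omega> \<in> space M. x \<le> \<xi> \<omega> \<and> \<xi> \<omega> \<le> x + z}))"
  by (rule bdd_aboveI[of _ 1]) auto

lemma (in prob_space) concentration_fun_bounds:
  "0 \<le> concentration_fun M \<xi> z" "concentration_fun M \<xi> z \<le> 1"
  unfolding concentration_fun_def
  by (rule cSUP_upper2[OF bdd_above_concentration_fun], auto intro!: cSUP_least)

lemma (in prob_space) bdd_above_concentration_fun_diff:
  "bdd_above ((\<lambda>z. \<bar>concentration_fun M \<xi> z - folded_normal_cdf (z / b)\<bar>) ` A)"
proof (rule bdd_aboveI2[of _ _ 2])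
  interpret N: prob_space std_normal_distribution
    by (rule prob_space_normal_density) simp
  fix z :: real
  have "0 \<le> std_normal_cdf (z / b)" "std_normal_cdf (z / b) \<le> 1"
    by (simp_all add: std_normal_cdf_def cdf_def)
  then have "\<bar>folded_normal_cdf (z / b)\<bar> \<le> 1"
    by (auto simp: folded_normal_cdf_def)
  with concentration_fun_bounds[of \<xi> z]
  show "\<bar>concentration_fun M \<xi> z - folded_normal_cdf (z / b)\<bar> \<le> 2"
    by linarith
qed

end

theory Submission
  imports Defs
begin

text \<open>Since \<open>min (x\<^sup>2) (\<bar>x\<bar>\<^sup>3)\<close> is below both integrands, after normalising \<open>B\<^sub>n = 1\<close> it suffices to
  bound the error by \<open>7.4508 \<gamma>\<close> with \<open>\<gamma> = \<Sum>i. E min (X\<^sub>i\<^sup>2) (\<bar>X\<^sub>i\<bar>\<^sup>3)\<close>, and only \<open>\<gamma> \<le> 0.135\<close> matters.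
  Stein's method is applied to the indicator of an interval \<open>[a, b]\<close> rather than to half-lines. Its
  Stein solution is the difference \<open>f\<^sub>b - f\<^sub>a\<close> of two half-line solutions; as both \<open>w f\<^sub>a(w)\<close> and
  \<open>w f\<^sub>b(w)\<close> increase, and as shifting an interval gains points at one end only, each increment of
  the derivative of the solution is bounded exactly as for a single half-line, so that no factor 2
  is lost. With \<open>\<bar>f\<^sub>z\<bar> \<le> sqrt (pi / 2) \<le> 1.3\<close> and Chen's concentration inequality for the sum of all
  but one variable, the smooth part and the concentration part contribute
  \<open>3/2 (2.3 + 1) \<gamma> = 4.95 \<gamma>\<close> and \<open>2.5 \<gamma>\<close>. The passage to concentration functions uses that the
  standard normal law charges a centred interval more than any other of the same length.\<close>

subsection \<open>The normal distribution function and Mills ratio\<close>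

text \<open>This passes from the distribution function of a measure to a Henstock-Kurzweil integral,
  to which the fundamental theorem of calculus applies. Closing the half-open interval costs
  nothing, as a single point is a null set.\<close>

lemma std_normal_cdf_diff:
  assumes "a \<le> b"
  shows "std_normal_cdf b - std_normal_cdf a = integral {a..b} std_normal_density"
proof -
  interpret N: real_distribution std_normal_distribution by (rule real_dist_normal_dist)
  have int: "set_integrable lborel {a..b} std_normal_density"
    by (rule borel_integrable_atLeastAtMost') (auto intro!: continuous_intros simp: std_normal_density_def[abs_def])
  have "std_normal_cdf b - std_normal_cdf a = measure std_normal_distribution {a<..b}"
  proof (cases "a < b")
    case True
    then show ?thesis unfolding std_normal_cdf_def by (rule N.cdf_diff_eq)
  qed (use assms in auto)
  also have "\<dots> = measure std_normal_distribution {a..b}"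
  proof (rule measure_eq_AE)
    have "AE x in lborel. x \<noteq> a" by (rule AE_lborel_singleton)
    then show "AE x in std_normal_distribution. (x \<in> {a<..b}) = (x \<in> {a..b})"
      by (subst AE_density) auto
  qed auto
  also have "\<dots> = (LINT x:{a..b}|lborel. std_normal_density x)"
  proof -
    have "emeasure std_normal_distribution {a..b} = (\<integral>\<^sup>+ x. ennreal (indicator {a..b} x * std_normal_density x) \<partial>lborel)"
      by (subst emeasure_density) (auto intro!: nn_integral_cong simp: indicator_def)
    also have "\<dots> = ennreal (LINT x:{a..b}|lborel. std_normal_density x)"
      unfolding set_lebesgue_integral_def
      using int by (subst nn_integral_eq_integral) (auto simp: set_integrable_def)
    finally show ?thesis unfolding measure_def
      by (simp add: set_lebesgue_integral_def Bochner_Integration.integral_nonneg)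
  qed
  also have "\<dots> = integral {a..b} std_normal_density"
    by (rule set_borel_integral_eq_integral(2)[OF int])
  finally show ?thesis .
qed

lemma DERIV_std_normal_cdf [derivative_intros]:
  assumes "(f has_real_derivative f') (at x within s)"
  shows "((\<lambda>x. std_normal_cdf (f x)) has_real_derivative std_normal_density (f x) * f') (at x within s)"
proof -
  have "(std_normal_cdf has_real_derivative std_normal_density x) (at x)" for x
  proof -
    \<comment> \<open>The base point x - 1 is an arbitrary point to the left of x: near x the
      distribution function is its value there plus an integral of the continuous density.\<close>
    have "((\<lambda>y. integral {x - 1..y} std_normal_density) has_real_derivative std_normal_density x) (at x within {x-1..x+1})"
      by (rule integral_has_real_derivative) (auto intro!: continuous_intros simp: std_normal_density_def[abs_def])
    then have "((\<lambda>y. integral {x - 1..y} std_normal_density) has_real_derivative std_normal_density x) (at x)"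
      by (simp add: at_within_Icc_at)
    then have "((\<lambda>y. std_normal_cdf (x - 1) + integral {x - 1..y} std_normal_density) has_real_derivative std_normal_density x) (at x)"
      by (auto intro!: derivative_eq_intros)
    then show ?thesis
    proof (rule has_field_derivative_transform_within_open)
      show "open {x - 1<..<x + 1}" "x \<in> {x - 1<..<x + 1}" by auto
      show "std_normal_cdf (x - 1) + integral {x - 1..y} std_normal_density = std_normal_cdf y"
        if "y \<in> {x - 1<..<x + 1}" for y
        using std_normal_cdf_diff[of "x - 1" y] that by auto
    qed
  qed
  from DERIV_chain2[OF this assms] show ?thesis .
qed

lemma DERIV_std_normal_density [derivative_intros]:
  assumes "(f has_real_derivative f') (at x within s)"
  shows "((\<lambda>x. std_normal_density (f x)) has_real_derivative - (f x) * std_normal_density (f x) * f') (at x within s)"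
proof -
  have "(std_normal_density has_real_derivative - x * std_normal_density x) (at x)" for x
    unfolding std_normal_density_def[abs_def]
    by (auto intro!: derivative_eq_intros simp: field_simps)
  from DERIV_chain2[OF this assms] show ?thesis .
qed

lemma std_normal_density_pos: "std_normal_density x > 0"
  by (simp add: normal_density_pos)

lemma std_normal_density_minus: "std_normal_density (- x) = std_normal_density x"
  by (simp add: std_normal_density_def)

lemma std_normal_cdf_nonneg: "0 \<le> std_normal_cdf x"
  and std_normal_cdf_le_1: "std_normal_cdf x \<le> 1"
proof -
  interpret N: real_distribution std_normal_distribution by (rule real_dist_normal_dist)
  show "0 \<le> std_normal_cdf x" "std_normal_cdf x \<le> 1"
    by (simp_all add: std_normal_cdf_def cdf_def)
qed

lemma std_normal_cdf_mono: "x \<le> y \<Longrightarrow> std_normal_cdf x \<le> std_normal_cdf y"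
proof -
  interpret N: real_distribution std_normal_distribution by (rule real_dist_normal_dist)
  show "x \<le> y \<Longrightarrow> std_normal_cdf x \<le> std_normal_cdf y"
    by (simp add: std_normal_cdf_def N.cdf_nondecreasing)
qed

lemma std_normal_cdf_at_top: "(std_normal_cdf \<longlongrightarrow> 1) at_top"
  and std_normal_cdf_at_bot: "(std_normal_cdf \<longlongrightarrow> 0) at_bot"
proof -
  interpret N: real_distribution std_normal_distribution by (rule real_dist_normal_dist)
  show "(std_normal_cdf \<longlongrightarrow> 1) at_top" "(std_normal_cdf \<longlongrightarrow> 0) at_bot"
    unfolding std_normal_cdf_def by (rule N.cdf_lim_at_top_prob N.cdf_lim_at_bot)+
qed

text \<open>The density is even, so Phi(-x) + Phi(x) has derivative 0; its constant value is the
  limit 0 + 1 at infinity.\<close>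

lemma std_normal_cdf_minus: "std_normal_cdf (- x) = 1 - std_normal_cdf x"
proof -
  let ?s = "\<lambda>x. std_normal_cdf (- x) + std_normal_cdf x"
  have "(?s has_real_derivative 0) (at y)" for y
    by (auto intro!: derivative_eq_intros simp: std_normal_density_minus)
  then have const: "?s y = ?s x" for y
    by (intro DERIV_isconst_all) auto
  have "(?s \<longlongrightarrow> 0 + 1) at_top"
    by (intro tendsto_add std_normal_cdf_at_top
        filterlim_compose[OF std_normal_cdf_at_bot filterlim_uminus_at_bot_at_top])
  then have "((\<lambda>_::real. ?s x) \<longlongrightarrow> 0 + 1) at_top"
    by (rule Lim_transform_eventually) (rule always_eventually, rule allI, rule const)
  then have "0 + 1 = ?s x"
    by (rule tendsto_unique[OF trivial_limit_at_top_linorder _ tendsto_const])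
  then show ?thesis by simp
qed

lemma std_normal_cdf_0: "std_normal_cdf 0 = 1 / 2"
  using std_normal_cdf_minus[of 0] by simp

text \<open>For x > 0 the function phi(x) / x - (1 - Phi(x)) has derivative -phi(x) / x^2 and limit
  0 at infinity, hence is positive.\<close>

lemma std_normal_tail_upper: "x * (1 - std_normal_cdf x) \<le> std_normal_density x"
proof (cases "x > 0")
  case False
  then have "x * (1 - std_normal_cdf x) \<le> 0"
    using std_normal_cdf_le_1[of x] by (simp add: mult_nonpos_nonneg)
  with std_normal_density_pos[of x] show ?thesis by linarith
next
  case True
  let ?u = "\<lambda>x. std_normal_density x / x - (1 - std_normal_cdf x)"
  have "0 < ?u x"
  proof (rule DERIV_neg_imp_decreasing_at_top[where f="?u"])
    fix y assume "x \<le> y"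
    with True have "y > 0" by simp
    show "\<exists>d. (?u has_real_derivative d) (at y) \<and> d < 0"
    proof (intro exI conjI)
      show "(?u has_real_derivative - std_normal_density y / y\<^sup>2) (at y)"
        using \<open>y > 0\<close> by (auto intro!: derivative_eq_intros simp: field_simps power2_eq_square)
      show "- std_normal_density y / y\<^sup>2 < 0"
        using \<open>y > 0\<close> std_normal_density_pos[of y] by (simp add: divide_neg_pos)
    qed
  next
    have "((\<lambda>x. std_normal_density x / x) \<longlongrightarrow> 0) at_top"
      unfolding std_normal_density_def by real_asymp
    from tendsto_diff[OF this tendsto_diff[OF tendsto_const[of 1] std_normal_cdf_at_top]]
    show "(?u \<longlongrightarrow> 0) at_top" by simp
  qed
  with True show ?thesis by (simp add: field_simps)
qed

text \<open>The function 1 - Phi(x) - x phi(x) / (1 + x^2) has limit 0 at infinity, and its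
  derivative collapses to -2 phi(x) / (1 + x^2)^2, so it is positive whatever the sign of x. This
  bound is what makes \<open>x * mills_ratio x\<close> increase.\<close>

lemma std_normal_tail_lower: "x * std_normal_density x \<le> (1 + x\<^sup>2) * (1 - std_normal_cdf x)"
proof -
  let ?u = "\<lambda>x. (1 - std_normal_cdf x) - x * std_normal_density x / (1 + x\<^sup>2)"
  have "0 < ?u x"
  proof (rule DERIV_neg_imp_decreasing_at_top[where f="?u"])
    fix y assume "x \<le> y"
    have "1 + y\<^sup>2 > 0" by (simp add: add_pos_nonneg)
    show "\<exists>d. (?u has_real_derivative d) (at y) \<and> d < 0"
    proof (intro exI conjI)
      have "(?u has_real_derivative - std_normal_density y -
          ((std_normal_density y - y * y * std_normal_density y) * (1 + y\<^sup>2) - y * std_normal_density y * (2 * y))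
            / ((1 + y\<^sup>2) * (1 + y\<^sup>2))) (at y)"
        using \<open>1 + y\<^sup>2 > 0\<close> by (auto intro!: derivative_eq_intros)
      moreover have "- std_normal_density y -
          ((std_normal_density y - y * y * std_normal_density y) * (1 + y\<^sup>2) - y * std_normal_density y * (2 * y))
            / ((1 + y\<^sup>2) * (1 + y\<^sup>2)) = - 2 * std_normal_density y / (1 + y\<^sup>2)\<^sup>2"
        using \<open>1 + y\<^sup>2 > 0\<close>
        by (simp add: divide_simps) (simp add: algebra_simps power2_eq_square)
      ultimately show "(?u has_real_derivative - 2 * std_normal_density y / (1 + y\<^sup>2)\<^sup>2) (at y)"
        by simp
      show "- 2 * std_normal_density y / (1 + y\<^sup>2)\<^sup>2 < 0"
        using \<open>1 + y\<^sup>2 > 0\<close> std_normal_density_pos[of y] by (simp add: divide_neg_pos)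
    qed
  next
    have "((\<lambda>x. x * std_normal_density x / (1 + x\<^sup>2)) \<longlongrightarrow> 0) at_top"
      unfolding std_normal_density_def by real_asymp
    from tendsto_diff[OF tendsto_diff[OF tendsto_const[of 1] std_normal_cdf_at_top] this]
    show "(?u \<longlongrightarrow> 0) at_top" by simp
  qed
  moreover have "1 + x\<^sup>2 > 0" by (simp add: add_pos_nonneg)
  ultimately have "x * std_normal_density x < (1 - std_normal_cdf x) * (1 + x\<^sup>2)"
    by (simp only: pos_divide_less_eq[symmetric])
  then show ?thesis by (simp add: mult.commute)
qed

text \<open>The derivative in \<open>u\<close> is phi(u + d) - phi(u). As the density decreases in
  |x|, it is nonnegative up to u = -d/2 and nonpositive from there on, so the centred interval
  carries the most mass.\<close>

lemma std_normal_cdf_interval_le: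
  assumes "0 \<le> d"
  shows "std_normal_cdf (u + d) - std_normal_cdf u \<le> 2 * std_normal_cdf (d / 2) - 1"
proof -
  let ?k = "\<lambda>u. std_normal_cdf (u + d) - std_normal_cdf u"
  have D: "(?k has_real_derivative std_normal_density (v + d) - std_normal_density v) (at v)" for v
    by (auto intro!: derivative_eq_intros)
  have mono: "std_normal_density x \<le> std_normal_density y" if "y\<^sup>2 \<le> x\<^sup>2" for x y
    using that by (auto simp: std_normal_density_def intro!: divide_right_mono)
  have "?k u \<le> ?k (- d / 2)"
  proof (cases "u \<le> - d / 2")
    case True
    have "0 \<le> std_normal_density (v + d) - std_normal_density v" if "v \<le> - d / 2" for v
    proof -
      have "d * (2 * v + d) \<le> 0" using assms that by (intro mult_nonneg_nonpos) auto
      then have "(v + d)\<^sup>2 \<le> v\<^sup>2" by (simp add: power2_eq_square algebra_simps)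
      then show ?thesis using mono by simp
    qed
    then show ?thesis
      using True D by (intro DERIV_nonneg_imp_nondecreasing[of u "- d / 2" ?k]) blast+
  next
    case False
    have "std_normal_density (v + d) - std_normal_density v \<le> 0" if "- d / 2 \<le> v" for v
    proof -
      have "0 \<le> d * (2 * v + d)" using assms that by (intro mult_nonneg_nonneg) auto
      then have "v\<^sup>2 \<le> (v + d)\<^sup>2" by (simp add: power2_eq_square algebra_simps)
      then show ?thesis using mono by simp
    qed
    then show ?thesis
      using False D by (intro DERIV_nonpos_imp_nonincreasing[of "- d / 2" u ?k]) (linarith, blast)
  qed
  also have "\<dots> = 2 * std_normal_cdf (d / 2) - 1"
    using std_normal_cdf_minus[of "d / 2"] by simp
  finally show ?thesis .
qed

section \<open>The Mills ratio and its monotonicity properties\<close>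

definition mills_ratio :: "real \<Rightarrow> real" where
  "mills_ratio x = (1 - std_normal_cdf x) / std_normal_density x"

lemma mills_ratio_nonneg: "0 \<le> mills_ratio x"
  using std_normal_cdf_le_1[of x] std_normal_density_pos[of x] by (simp add: mills_ratio_def)

lemma mult_mills_ratio_le_1: "x * mills_ratio x \<le> 1"
  using std_normal_tail_upper[of x] std_normal_density_pos[of x] by (simp add: mills_ratio_def field_simps)

text \<open>The Mills ratio solves m' = x m - 1, so that the two tail bounds become statements about
  the signs of derivatives.\<close>

lemma DERIV_mills_ratio [derivative_intros]:
  assumes "(f has_real_derivative f') (at x within s)"
  shows "((\<lambda>x. mills_ratio (f x)) has_real_derivative (f x * mills_ratio (f x) - 1) * f') (at x within s)"
proof -
  have "(mills_ratio has_real_derivative (x * mills_ratio x - 1)) (at x)" for x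
    unfolding mills_ratio_def[abs_def] using std_normal_density_pos[of x]
    by (auto intro!: derivative_eq_intros simp: field_simps)
  from DERIV_chain2[OF this assms] show ?thesis .
qed

lemma continuous_on_mills_ratio [continuous_intros]:
  "continuous_on A f \<Longrightarrow> continuous_on A (\<lambda>x. mills_ratio (f x))"
  by (rule continuous_on_compose2[of UNIV mills_ratio])
     (auto intro!: DERIV_continuous_on[where D="\<lambda>x. x * mills_ratio x - 1"] derivative_eq_intros)

lemma mills_ratio_antimono: "x \<le> y \<Longrightarrow> mills_ratio y \<le> mills_ratio x"
proof (rule DERIV_nonpos_imp_nonincreasing[where f=mills_ratio])
  fix t show "\<exists>d. (mills_ratio has_real_derivative d) (at t) \<and> d \<le> 0"
    using mult_mills_ratio_le_1[of t]
    by (intro exI[of _ "t * mills_ratio t - 1"]) (auto intro!: derivative_eq_intros)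
qed

text \<open>The derivative is (1 + t^2) m(t) - t, whose sign is the lower tail bound.\<close>

lemma mult_mills_ratio_mono: "x \<le> y \<Longrightarrow> x * mills_ratio x \<le> y * mills_ratio y"
proof (rule DERIV_nonneg_imp_nondecreasing[where f="\<lambda>x. x * mills_ratio x"])
  fix t
  have "t \<le> (1 + t\<^sup>2) * mills_ratio t"
    using std_normal_tail_lower[of t] std_normal_density_pos[of t] by (simp add: mills_ratio_def field_simps)
  then show "\<exists>d. ((\<lambda>x. x * mills_ratio x) has_real_derivative d) (at t) \<and> 0 \<le> d"
    by (intro exI[of _ "(1 + t\<^sup>2) * mills_ratio t - t"])
       (auto intro!: derivative_eq_intros simp: algebra_simps power2_eq_square)
qed

text \<open>The exact value is sqrt(pi / 2), about 1.2533; it becomes the uniform bound on all Stein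
  solutions.\<close>

lemma mills_ratio_0: "mills_ratio 0 \<le> 1.3"
proof -
  have "2 * pi \<le> (2.6)\<^sup>2"
    using pi_less_4 pi_approx by (simp add: power2_eq_square)
  then have "sqrt (2 * pi) \<le> 2.6" by (intro real_le_lsqrt) auto
  then show ?thesis
    by (simp add: mills_ratio_def std_normal_cdf_0 std_normal_density_def)
qed

subsection \<open>Stein solutions\<close>

text \<open>The bounded solution f of f'(w) - w f(w) = 1(w \<le> z) - Phi(z), usually written sqrt(2
  pi) exp(w^2 / 2) Phi(min(w, z)) (1 - Phi(max(w, z))).\<close>

definition stein_sol :: "real \<Rightarrow> real \<Rightarrow> real" where
  "stein_sol z w = (if w \<le> z then mills_ratio (- w) * (1 - std_normal_cdf z) else mills_ratio w * std_normal_cdf z)"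

text \<open>The Stein equation solved for the derivative. This also assigns a value at the kink w =
  z, namely the left derivative there.\<close>

definition stein_deriv :: "real \<Rightarrow> real \<Rightarrow> real" where
  "stein_deriv z w = w * stein_sol z w + (if w \<le> z then 1 else 0) - std_normal_cdf z"

lemma mills_ratio_minus: "mills_ratio (- w) = std_normal_cdf w / std_normal_density w"
  by (simp add: mills_ratio_def std_normal_cdf_minus std_normal_density_minus)

lemma mills_ratio_join: "mills_ratio (- z) * (1 - std_normal_cdf z) = mills_ratio z * std_normal_cdf z"
  unfolding mills_ratio_minus by (simp add: mills_ratio_def)

lemma stein_sol_right: "z \<le> w \<Longrightarrow> stein_sol z w = mills_ratio w * std_normal_cdf z"
  using mills_ratio_join[of z] by (cases "w = z") (simp_all add: stein_sol_def)

text \<open>Reflection swaps the two tails, which reduces claims for w > z to claims for w \<le> z.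
  At w = z the two branches agree by \<open>mills_ratio_join\<close>.\<close>

lemma stein_sol_reflect: "stein_sol (- z) (- w) = stein_sol z w"
  using mills_ratio_join[of z] by (auto simp: stein_sol_def std_normal_cdf_minus)

lemma continuous_on_stein_sol: "continuous_on A (stein_sol z)"
proof -
  have "continuous_on ({..z} \<union> {z..}) (\<lambda>w. if w \<le> z then mills_ratio (- w) * (1 - std_normal_cdf z) else mills_ratio w * std_normal_cdf z)"
    using mills_ratio_join[of z] by (intro continuous_on_If continuous_intros) auto
  also have "{..z} \<union> {z..} = UNIV" by auto
  finally show ?thesis unfolding stein_sol_def[abs_def]
    by (rule continuous_on_subset) simp
qed

lemma DERIV_stein_sol:
  assumes "w \<noteq> z"
  shows "(stein_sol z has_real_derivative stein_deriv z w) (at w)"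
proof (cases "w < z")
  case True
  have "((\<lambda>w. mills_ratio (- w) * (1 - std_normal_cdf z)) has_real_derivative stein_deriv z w) (at w)"
    using True by (auto intro!: derivative_eq_intros simp: stein_deriv_def stein_sol_def algebra_simps)
  then show ?thesis
    by (rule has_field_derivative_transform_within_open[of _ _ _ "{..<z}"]) (use True in \<open>auto simp: stein_sol_def\<close>)
next
  case False
  with assms have "z < w" by simp
  have "((\<lambda>w. mills_ratio w * std_normal_cdf z) has_real_derivative stein_deriv z w) (at w)"
    using \<open>z < w\<close> by (auto intro!: derivative_eq_intros simp: stein_deriv_def stein_sol_def algebra_simps)
  then show ?thesis
    by (rule has_field_derivative_transform_within_open[of _ _ _ "{z<..}"]) (use \<open>z < w\<close> in \<open>auto simp: stein_sol_def\<close>)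
qed

lemma stein_sol_nonneg: "0 \<le> stein_sol z w"
  by (simp add: stein_sol_def mills_ratio_nonneg std_normal_cdf_nonneg std_normal_cdf_le_1)

text \<open>Let w \<le> z. If w \<le> 0, the Mills ratio is taken at -w \<ge> 0, where it is at most
  its value at 0. Otherwise z is lowered to w and the joining identity moves to the other branch,
  whose argument is again positive. Reflection covers w > z.\<close>

lemma stein_sol_le: "stein_sol z w \<le> 1.3"
proof -
  have *: "stein_sol z w \<le> mills_ratio 0" if "w \<le> z" for z w
  proof (cases "w \<le> 0")
    case True
    have "stein_sol z w = mills_ratio (- w) * (1 - std_normal_cdf z)" using that by (simp add: stein_sol_def)
    also have "\<dots> \<le> mills_ratio 0 * 1"
      using True by (intro mult_mono mills_ratio_antimono) (auto simp: std_normal_cdf_nonneg mills_ratio_nonneg std_normal_cdf_le_1)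
    finally show ?thesis by simp
  next
    case False
    have "stein_sol z w = mills_ratio (- w) * (1 - std_normal_cdf z)" using that by (simp add: stein_sol_def)
    also have "\<dots> \<le> mills_ratio (- w) * (1 - std_normal_cdf w)"
      using that by (intro mult_left_mono) (auto simp: std_normal_cdf_mono mills_ratio_nonneg)
    also have "\<dots> = mills_ratio w * std_normal_cdf w" by (rule mills_ratio_join)
    also have "\<dots> \<le> mills_ratio 0 * 1"
      using False by (intro mult_mono mills_ratio_antimono) (auto simp: std_normal_cdf_nonneg mills_ratio_nonneg std_normal_cdf_le_1)
    finally show ?thesis by simp
  qed
  have "stein_sol z w \<le> mills_ratio 0"
  proof (cases "w \<le> z")
    case False
    then show ?thesis using *[of "- w" "- z"] by (simp add: stein_sol_reflect)
  qed (rule *)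
  with mills_ratio_0 show ?thesis by simp
qed

text \<open>Left of z the derivative factors as
  \<open>(1 + w * mills_ratio (- w)) * (1 - std_normal_cdf z)\<close>, where the first factor is
  nonnegative by the Mills bound. For w > 0 it exceeds 1, which is compensated by lowering z to w
  and using the joining identity. Reflection covers w > z.\<close>

lemma abs_stein_deriv_le_1: "\<bar>stein_deriv z w\<bar> \<le> 1"
proof -
  have *: "0 \<le> (1 + w * mills_ratio (- w)) * (1 - std_normal_cdf z) \<and> (1 + w * mills_ratio (- w)) * (1 - std_normal_cdf z) \<le> 1"
    (is "0 \<le> ?l * ?r \<and> _") if "w \<le> z" for z w
  proof
    have l: "0 \<le> ?l" using mult_mills_ratio_le_1[of "- w"] by simp
    have r: "0 \<le> ?r" "?r \<le> 1" by (simp_all add: std_normal_cdf_le_1 std_normal_cdf_nonneg)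
    show "0 \<le> ?l * ?r" using l r by simp
    show "?l * ?r \<le> 1"
    proof (cases "w \<le> 0")
      case True
      then have "?l \<le> 1" using mills_ratio_nonneg[of "- w"] by (simp add: mult_nonpos_nonneg)
      with l r show ?thesis by (simp add: mult_le_one)
    next
      case False
      have "?l * ?r \<le> ?l * (1 - std_normal_cdf w)"
        using that l by (intro mult_left_mono) (auto simp: std_normal_cdf_mono)
      also have "\<dots> = 1 - std_normal_cdf w + w * mills_ratio w * std_normal_cdf w"
      proof -
        have "?l * (1 - std_normal_cdf w) = 1 - std_normal_cdf w + w * (mills_ratio (- w) * (1 - std_normal_cdf w))"
          by (simp add: algebra_simps)
        then show ?thesis by (simp only: mills_ratio_join mult.assoc)
      qed
      also have "\<dots> \<le> 1 - std_normal_cdf w + 1 * std_normal_cdf w"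
        by (intro add_left_mono mult_right_mono mult_mills_ratio_le_1 std_normal_cdf_nonneg)
      finally show ?thesis by simp
    qed
  qed
  show ?thesis
  proof (cases "w \<le> z")
    case True
    with *[OF True] show ?thesis by (simp add: stein_deriv_def stein_sol_def algebra_simps)
  next
    case False
    with *[of "- w" "- z"] show ?thesis
      by (simp add: stein_deriv_def stein_sol_def algebra_simps std_normal_cdf_minus)
  qed
qed

lemma stein_deriv_has_integral:
  assumes "a \<le> b"
  shows "(stein_deriv z has_integral (stein_sol z b - stein_sol z a)) {a..b}"
proof (rule fundamental_theorem_of_calculus_interior_strong[of "{z}"])
  show "(stein_sol z has_vector_derivative stein_deriv z x) (at x)" if "x \<in> {a<..<b} - {z}" for x
    using that DERIV_stein_sol[of x z] by (simp add: has_real_derivative_iff_has_vector_derivative)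
qed (use assms in \<open>auto intro: continuous_on_stein_sol\<close>)

lemma stein_sol_lipschitz: "\<bar>stein_sol z b - stein_sol z a\<bar> \<le> \<bar>b - a\<bar>"
proof -
  have *: "\<bar>stein_sol z b - stein_sol z a\<bar> \<le> b - a" if "a \<le> b" for a b
    using has_integral_bound[of 1 "stein_deriv z" "stein_sol z b - stein_sol z a" a b]
      stein_deriv_has_integral[OF that, of z] abs_stein_deriv_le_1[of z] that by simp
  show ?thesis using *[of a b] *[of b a] by (cases "a \<le> b") auto
qed

text \<open>Each branch is monotone by \<open>mult_mills_ratio_mono\<close>; points on different
  sides of z are compared through z.\<close>

lemma stein_sol_mult_mono:
  assumes "x \<le> y"
  shows "x * stein_sol z x \<le> y * stein_sol z y"
proof -
  have l: "x * stein_sol z x \<le> y * stein_sol z y" if "x \<le> y" "y \<le> z" for x y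
    using mult_right_mono[OF mult_mills_ratio_mono[of "- y" "- x"], of "1 - std_normal_cdf z"] that
    by (simp add: stein_sol_def std_normal_cdf_le_1 algebra_simps)
  have r: "x * stein_sol z x \<le> y * stein_sol z y" if "x \<le> y" "z \<le> x" for x y
    using mult_right_mono[OF mult_mills_ratio_mono[of x y], of "std_normal_cdf z"] that
    by (simp add: stein_sol_right std_normal_cdf_nonneg mult.assoc)
  consider "y \<le> z" | "z \<le> x" | "x \<le> z" "z \<le> y" by linarith
  then show ?thesis
    by cases (use l[of x y] r[of x y] l[of x z] r[of z y] assms in auto)
qed

text \<open>Right of z the upper bound is the Mills bound; monotonicity extends it to the left and
  reflection gives the lower bound. In total w f(w) varies by at most 1.\<close>

lemma stein_sol_mult_range:
  "- (1 - std_normal_cdf z) \<le> w * stein_sol z w" "w * stein_sol z w \<le> std_normal_cdf z"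
proof -
  have r: "w * stein_sol z w \<le> std_normal_cdf z" if "z \<le> w" for w z
    using mult_right_mono[OF mult_mills_ratio_le_1[of w], of "std_normal_cdf z"] that
    by (simp add: stein_sol_right std_normal_cdf_nonneg mult.assoc)
  have u: "w * stein_sol z w \<le> std_normal_cdf z" for w z
    using r[of z "max w z"] stein_sol_mult_mono[of w "max w z" z] by simp
  show "w * stein_sol z w \<le> std_normal_cdf z" by (rule u)
  show "- (1 - std_normal_cdf z) \<le> w * stein_sol z w"
    using u[of "- w" "- z"] by (simp add: stein_sol_reflect std_normal_cdf_minus)
qed

text \<open>The bound 1 is the length of the range of w f(w). The other bound splits the increment
  into w (f(w + t) - f(w + s)) + t f(w + t) - s f(w + s) and uses the Lipschitz constant 1 and the
  bound 1.3. Nonnegativity matters as much: two increments in a common interval [0, G] have a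
  difference in [-G, G].\<close>

lemma stein_sol_mult_increment:
  assumes "s \<le> t"
  shows "0 \<le> (w + t) * stein_sol z (w + t) - (w + s) * stein_sol z (w + s)"
    and "(w + t) * stein_sol z (w + t) - (w + s) * stein_sol z (w + s) \<le> min 1 ((\<bar>w\<bar> + 1.3) * (\<bar>s\<bar> + \<bar>t\<bar>))"
proof -
  show "0 \<le> (w + t) * stein_sol z (w + t) - (w + s) * stein_sol z (w + s)"
    using stein_sol_mult_mono[of "w + s" "w + t" z] assms by simp
  have "w * (stein_sol z (w + t) - stein_sol z (w + s)) \<le> \<bar>w\<bar> * (\<bar>s\<bar> + \<bar>t\<bar>)"
  proof -
    have "w * (stein_sol z (w + t) - stein_sol z (w + s)) \<le> \<bar>w\<bar> * \<bar>stein_sol z (w + t) - stein_sol z (w + s)\<bar>"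
      by (metis abs_ge_self abs_mult)
    also have "\<dots> \<le> \<bar>w\<bar> * (\<bar>s\<bar> + \<bar>t\<bar>)"
      using stein_sol_lipschitz[of z "w + t" "w + s"] by (intro mult_left_mono) auto
    finally show ?thesis .
  qed
  moreover have "t * stein_sol z (w + t) \<le> \<bar>t\<bar> * 1.3"
    by (intro mult_mono stein_sol_le stein_sol_nonneg) auto
  moreover have "- s * stein_sol z (w + s) \<le> \<bar>s\<bar> * 1.3"
    by (intro mult_mono stein_sol_le stein_sol_nonneg) auto
  moreover have "(w + t) * stein_sol z (w + t) - (w + s) * stein_sol z (w + s) =
      w * (stein_sol z (w + t) - stein_sol z (w + s)) + t * stein_sol z (w + t) + - s * stein_sol z (w + s)"
    by (simp add: algebra_simps)
  moreover have "(\<bar>w\<bar> + 1.3) * (\<bar>s\<bar> + \<bar>t\<bar>) = \<bar>w\<bar> * (\<bar>s\<bar> + \<bar>t\<bar>) + \<bar>t\<bar> * 1.3 + \<bar>s\<bar> * 1.3"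
    by (simp add: algebra_simps)
  ultimately have "(w + t) * stein_sol z (w + t) - (w + s) * stein_sol z (w + s) \<le> (\<bar>w\<bar> + 1.3) * (\<bar>s\<bar> + \<bar>t\<bar>)"
    by linarith
  then show "(w + t) * stein_sol z (w + t) - (w + s) * stein_sol z (w + s) \<le> min 1 ((\<bar>w\<bar> + 1.3) * (\<bar>s\<bar> + \<bar>t\<bar>))"
    using stein_sol_mult_range(2)[where w="w + t" and z=z] stein_sol_mult_range(1)[where w="w + s" and z=z] by simp
qed

section \<open>Stein solutions for intervals\<close>

definition stein_int :: "real \<Rightarrow> real \<Rightarrow> real \<Rightarrow> real" where
  "stein_int a b w = stein_sol b w - stein_sol a w"

text \<open>The indicator is that of the closed interval, as in the definition of the concentration
  function, whereas for a \<le> b the difference \<open>stein_deriv b w - stein_deriv a w\<close>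
  involves the half-open one. The two differ only at w = a, which integrals over w do not
  see.\<close>

definition stein_int_deriv :: "real \<Rightarrow> real \<Rightarrow> real \<Rightarrow> real" where
  "stein_int_deriv a b w = w * stein_int a b w + indicator {a..b} w - (std_normal_cdf b - std_normal_cdf a)"

lemma stein_sol_measurable [measurable]: "stein_sol z \<in> borel_measurable borel"
  by (intro borel_measurable_continuous_onI continuous_on_stein_sol)

lemma stein_int_measurable [measurable]: "stein_int a b \<in> borel_measurable borel"
  unfolding stein_int_def[abs_def] by measurable

lemma stein_int_deriv_measurable [measurable]: "stein_int_deriv a b \<in> borel_measurable borel"
  unfolding stein_int_deriv_def[abs_def] by measurable

lemma continuous_on_stein_int: "continuous_on A (stein_int a b)"
  unfolding stein_int_def[abs_def] by (intro continuous_on_diff continuous_on_stein_sol)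

lemma abs_stein_int_le: "\<bar>stein_int a b w\<bar> \<le> 1.3"
  using stein_sol_nonneg[of a w] stein_sol_nonneg[of b w] stein_sol_le[of a w] stein_sol_le[of b w]
  unfolding stein_int_def abs_le_iff by linarith

lemma abs_stein_int_mult_le: "\<bar>w * stein_int a b w\<bar> \<le> 2"
  using stein_sol_mult_range[where z=a and w=w] stein_sol_mult_range[where z=b and w=w]
    std_normal_cdf_nonneg[of a] std_normal_cdf_nonneg[of b] std_normal_cdf_le_1[of a] std_normal_cdf_le_1[of b]
  by (simp add: stein_int_def algebra_simps)

text \<open>A crude bound, serving integrability.\<close>

lemma abs_stein_int_deriv_le: "\<bar>stein_int_deriv a b w\<bar> \<le> 4"
  using abs_stein_int_mult_le[of w a b]
    std_normal_cdf_nonneg[of a] std_normal_cdf_nonneg[of b] std_normal_cdf_le_1[of a] std_normal_cdf_le_1[of b]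
  by (auto simp: stein_int_deriv_def indicator_def abs_le_iff)

lemma DERIV_stein_int:
  assumes "w \<noteq> a" "w \<noteq> b" "a \<le> b"
  shows "(stein_int a b has_real_derivative stein_int_deriv a b w) (at w)"
proof -
  have "((\<lambda>w. stein_sol b w - stein_sol a w) has_real_derivative stein_deriv b w - stein_deriv a w) (at w)"
    by (intro DERIV_diff DERIV_stein_sol assms)
  also have "stein_deriv b w - stein_deriv a w = stein_int_deriv a b w"
    using assms by (auto simp: stein_deriv_def stein_int_deriv_def stein_int_def indicator_def algebra_simps)
  finally show ?thesis by (simp add: stein_int_def[abs_def])
qed

text \<open>Parametrising the segment from v to v + x by [0, 1] treats both signs of x at once. The
  exceptional parameters are those at which the segment meets a or b.\<close>

lemma stein_int_increment:
  assumes "a \<le> b"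
  shows "((\<lambda>u. x * stein_int_deriv a b (v + u * x)) has_integral (stein_int a b (v + x) - stein_int a b v)) {0..1}"
proof (cases "x = 0")
  case False
  have "((\<lambda>u. x * stein_int_deriv a b (v + u * x)) has_integral (stein_int a b (v + 1 * x) - stein_int a b (v + 0 * x))) {0..1}"
  proof (rule fundamental_theorem_of_calculus_interior_strong[of "{(a - v) / x, (b - v) / x}"])
    show "continuous_on {0..1} (\<lambda>u. stein_int a b (v + u * x))"
      by (rule continuous_on_compose2[OF continuous_on_stein_int[of UNIV]]) (auto intro!: continuous_intros)
    fix u assume "u \<in> {0<..<1} - {(a - v) / x, (b - v) / x}"
    then have "v + u * x \<noteq> a" "v + u * x \<noteq> b" using False by (auto simp: field_simps)
    from DERIV_stein_int[OF this \<open>a \<le> b\<close>]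
    have "((\<lambda>u. stein_int a b (v + u * x)) has_real_derivative stein_int_deriv a b (v + u * x) * x) (at u)"
      by (rule DERIV_chain2) (auto intro!: derivative_eq_intros)
    then show "((\<lambda>u. stein_int a b (v + u * x)) has_vector_derivative x * stein_int_deriv a b (v + u * x)) (at u)"
      by (simp add: has_real_derivative_iff_has_vector_derivative mult.commute)
  qed auto
  then show ?thesis by simp
qed simp

subsection \<open>Concentration of sums of independent variables\<close>

lemma integrable_mult_bounded:
  fixes X g :: "'a \<Rightarrow> real"
  assumes "integrable M X" "g \<in> borel_measurable M" "\<And>x. \<bar>g x\<bar> \<le> C"
  shows "integrable M (\<lambda>x. X x * g x)"
proof (rule Bochner_Integration.integrable_bound)
  show "integrable M (\<lambda>x. C * X x)" using assms(1) by simp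
  show "(\<lambda>x. X x * g x) \<in> borel_measurable M"
    using assms by (intro borel_measurable_times) auto
  have "\<bar>X x\<bar> * \<bar>g x\<bar> \<le> C * \<bar>X x\<bar>" for x
    using mult_right_mono[OF assms(3)[of x], of "\<bar>X x\<bar>"] by (simp add: mult.commute)
  moreover have "C * \<bar>X x\<bar> \<le> \<bar>C * X x\<bar>" for x
    by (metis abs_ge_self abs_mult abs_abs mult.commute mult_right_mono abs_ge_zero)
  ultimately show "AE x in M. norm (X x * g x) \<le> norm (C * X x)"
    by (intro AE_I2) (simp add: abs_mult, meson order_trans)
qed

context prob_space begin

lemma indep_vars_rv: "indep_vars (\<lambda>_. borel) Y J \<Longrightarrow> i \<in> J \<Longrightarrow> random_variable borel (Y i)"
  by (simp add: indep_vars_def)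

lemma indep_var_sum_others:
  fixes Y :: "'i \<Rightarrow> 'a \<Rightarrow> real"
  assumes "finite J" "indep_vars (\<lambda>_. borel) Y J" "i \<in> J"
  shows "indep_var borel (Y i) borel (\<lambda>\<omega>. \<Sum>k\<in>J - {i}. Y k \<omega>)"
  using assms by (intro indep_vars_sum) (auto simp: insert_absorb)

lemma
  fixes Y :: "'i \<Rightarrow> 'a \<Rightarrow> real"
  assumes "finite J" "indep_vars (\<lambda>_. borel) Y J"
    and "\<And>i. i \<in> J \<Longrightarrow> integrable M (\<lambda>\<omega>. (Y i \<omega>)\<^sup>2)"
    and "\<And>i. i \<in> J \<Longrightarrow> expectation (Y i) = 0"
  shows integrable_indep_sum_square: "integrable M (\<lambda>\<omega>. (\<Sum>i\<in>J. Y i \<omega>)\<^sup>2)" (is ?I)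
    and expectation_indep_sum_square:
      "expectation (\<lambda>\<omega>. (\<Sum>i\<in>J. Y i \<omega>)\<^sup>2) = (\<Sum>i\<in>J. expectation (\<lambda>\<omega>. (Y i \<omega>)\<^sup>2))" (is ?E)
proof -
  have "?I \<and> ?E" using assms
  proof (induction J rule: finite_induct)
    case (insert i J)
    let ?V = "\<lambda>\<omega>. \<Sum>i\<in>J. Y i \<omega>"
    have ind: "indep_vars (\<lambda>_. borel) Y J"
      by (rule indep_vars_subset[OF insert.prems(1)]) auto
    have IH: "integrable M (\<lambda>\<omega>. (?V \<omega>)\<^sup>2)"
      "expectation (\<lambda>\<omega>. (?V \<omega>)\<^sup>2) = (\<Sum>i\<in>J. expectation (\<lambda>\<omega>. (Y i \<omega>)\<^sup>2))"
      using insert.IH[OF ind] insert.prems by auto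
    have iv: "indep_var borel (Y i) borel ?V"
      using insert.hyps insert.prems by (intro indep_vars_sum) auto
    have int: "integrable M (Y k)" if "k \<in> insert i J" for k
      using indep_vars_rv[OF insert.prems(1) that] insert.prems(2)[OF that]
      by (rule square_integrable_imp_integrable)
    then have intV: "integrable M ?V" by (intro Bochner_Integration.integrable_sum) auto
    have intp: "integrable M (\<lambda>\<omega>. Y i \<omega> * ?V \<omega>)"
      by (rule indep_var_integrable[OF iv int intV]) simp
    have ep: "expectation (\<lambda>\<omega>. Y i \<omega> * ?V \<omega>) = 0"
      using indep_var_lebesgue_integral[OF iv int intV] insert.prems(3)[of i] by simp
    have eq: "(\<Sum>i\<in>insert i J. Y i \<omega>)\<^sup>2 = (Y i \<omega>)\<^sup>2 + 2 * (Y i \<omega> * ?V \<omega>) + (?V \<omega>)\<^sup>2" for \<omega>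
      using insert.hyps by (simp add: power2_sum)
    have int2: "integrable M (\<lambda>\<omega>. (Y i \<omega>)\<^sup>2)" using insert.prems(2) by simp
    show ?case unfolding eq using int2 intp ep IH insert.hyps by simp
  qed simp
  then show ?I ?E by auto
qed

text \<open>In place of the Cauchy-Schwarz inequality, 2 d |Z| \<le> Z^2 + d^2 is integrated; after
  division by 2 d each term on the right contributes at most d / 2.\<close>

lemma expectation_abs_le:
  fixes Z :: "'a \<Rightarrow> real"
  assumes "Z \<in> borel_measurable M" "integrable M (\<lambda>\<omega>. (Z \<omega>)\<^sup>2)" "expectation (\<lambda>\<omega>. (Z \<omega>)\<^sup>2) \<le> d\<^sup>2" "0 < d"
  shows "expectation (\<lambda>\<omega>. \<bar>Z \<omega>\<bar>) \<le> d"
proof -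
  have int: "integrable M Z" by (rule square_integrable_imp_integrable[OF assms(1,2)])
  have "\<bar>Z \<omega>\<bar> \<le> (Z \<omega>)\<^sup>2 / (2 * d) + d / 2" for \<omega>
  proof -
    have "0 \<le> (\<bar>Z \<omega>\<bar> - d)\<^sup>2" by simp
    then have "2 * d * \<bar>Z \<omega>\<bar> \<le> (Z \<omega>)\<^sup>2 + d\<^sup>2" by (simp add: power2_diff algebra_simps)
    then show ?thesis using assms(4) by (simp add: field_simps power2_eq_square)
  qed
  then have "expectation (\<lambda>\<omega>. \<bar>Z \<omega>\<bar>) \<le> expectation (\<lambda>\<omega>. (Z \<omega>)\<^sup>2 / (2 * d) + d / 2)"
    using int assms(2) by (intro integral_mono) auto
  also have "\<dots> = expectation (\<lambda>\<omega>. (Z \<omega>)\<^sup>2) / (2 * d) + d / 2"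
    using assms(2) by (simp add: prob_space)
  also have "\<dots> \<le> d\<^sup>2 / (2 * d) + d / 2"
    using assms(3,4) by (intro add_right_mono divide_right_mono) auto
  also have "\<dots> = d" using assms(4) by (simp add: power2_eq_square)
  finally show ?thesis .
qed

text \<open>Chen's concentration inequality, obtained by testing the sum against a truncated identity
  with slope one on the enlarged interval \<open>[a - d, b + d]\<close>.\<close>

lemma indep_sum_interval_prob:
  fixes Y :: "'i \<Rightarrow> 'a \<Rightarrow> real"
  assumes fin: "finite J" and ind: "indep_vars (\<lambda>_. borel) Y J"
    and sq: "\<And>i. i \<in> J \<Longrightarrow> integrable M (\<lambda>\<omega>. (Y i \<omega>)\<^sup>2)"
    and mean: "\<And>i. i \<in> J \<Longrightarrow> expectation (Y i) = 0"
    and var: "(\<Sum>i\<in>J. expectation (\<lambda>\<omega>. (Y i \<omega>)\<^sup>2)) \<le> 1"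
    and "0 < d" "a \<le> b"
    and mu: "m \<le> (\<Sum>i\<in>J. expectation (\<lambda>\<omega>. \<bar>Y i \<omega>\<bar> * min d \<bar>Y i \<omega>\<bar>))"
  shows "m * prob {\<omega> \<in> space M. a \<le> (\<Sum>i\<in>J. Y i \<omega>) \<and> (\<Sum>i\<in>J. Y i \<omega>) \<le> b} \<le> (b - a) / 2 + 3 / 2 * d"
proof -
  define V where "V \<omega> = (\<Sum>i\<in>J. Y i \<omega>)" for \<omega>
  define T where "T i \<omega> = \<bar>Y i \<omega>\<bar> * min d \<bar>Y i \<omega>\<bar>" for i \<omega>
  define U where "U \<omega> = (\<Sum>i\<in>J. T i \<omega>)" for \<omega>
  define A where "A = {\<omega> \<in> space M. a \<le> V \<omega> \<and> V \<omega> \<le> b}"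
  \<comment> \<open>Clipping only at distance d beyond the interval keeps slope one within d of
    every point of [a, b]. Subtracting the midpoint gives the symmetric bound (b - a) / 2 +
    d.\<close>
  define f where "f v = max (a - d) (min (b + d) v) - (a + b) / 2" for v :: real
  have rv [measurable]: "random_variable borel (Y i)" if "i \<in> J" for i
    using indep_vars_rv[OF ind that] .
  have rvV [measurable]: "random_variable borel V" unfolding V_def by measurable
  have rvT [measurable]: "random_variable borel (T i)" if "i \<in> J" for i
    using that unfolding T_def by measurable
  have rvU [measurable]: "random_variable borel U" unfolding U_def by measurable
  have [measurable]: "A \<in> sets M" unfolding A_def by measurable
  have rvf [measurable]: "f \<in> borel_measurable borel" unfolding f_def by measurable
  have int: "integrable M (Y i)" if "i \<in> J" for i
    using that by (intro square_integrable_imp_integrable[OF rv sq])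
  have intT: "integrable M (T i)" if "i \<in> J" for i
    unfolding T_def using that int \<open>0 < d\<close> by (intro integrable_mult_bounded[where C=d]) auto
  have intU: "integrable M U" unfolding U_def using intT by (intro Bochner_Integration.integrable_sum)
  have f_bound: "\<bar>f v\<bar> \<le> (b - a) / 2 + d" for v
    using \<open>a \<le> b\<close> \<open>0 < d\<close> by (auto simp: f_def max_def min_def abs_le_iff field_simps)
  have f_mono: "f v \<le> f w" if "v \<le> w" for v w
    using that by (auto simp: f_def)
  have intYf: "integrable M (\<lambda>\<omega>. Y i \<omega> * f (V \<omega>))" if "i \<in> J" for i
    using that int f_bound by (intro integrable_mult_bounded[where C="(b - a) / 2 + d"]) auto
  \<comment> \<open>The rest V - Y i is independent of Y i, which has mean zero, so this term can be
    subtracted at no cost in expectation.\<close>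
  have intYf': "integrable M (\<lambda>\<omega>. Y i \<omega> * f (V \<omega> - Y i \<omega>))"
    and eYf': "expectation (\<lambda>\<omega>. Y i \<omega> * f (V \<omega> - Y i \<omega>)) = 0" if "i \<in> J" for i
  proof -
    show "integrable M (\<lambda>\<omega>. Y i \<omega> * f (V \<omega> - Y i \<omega>))"
      using that int f_bound by (intro integrable_mult_bounded[where C="(b - a) / 2 + d"]) auto
    have V: "V \<omega> - Y i \<omega> = (\<Sum>k\<in>J - {i}. Y k \<omega>)" for \<omega>
      unfolding V_def using that fin by (simp add: sum_diff1)
    have "indep_var borel (id \<circ> Y i) borel (f \<circ> (\<lambda>\<omega>. \<Sum>k\<in>J - {i}. Y k \<omega>))"
      by (rule indep_var_compose[OF indep_var_sum_others[OF fin ind that]]) auto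
    then have iv: "indep_var borel (Y i) borel (\<lambda>\<omega>. f (V \<omega> - Y i \<omega>))"
      by (simp add: comp_def V)
    have intf: "integrable M (\<lambda>\<omega>. f (V \<omega> - Y i \<omega>))"
      using f_bound that by (intro integrable_const_bound[where B="(b - a) / 2 + d"]) auto
    show "expectation (\<lambda>\<omega>. Y i \<omega> * f (V \<omega> - Y i \<omega>)) = 0"
      using indep_var_lebesgue_integral[OF iv int[OF that] intf] mean[OF that] by simp
  qed
  \<comment> \<open>On A, passing from V - Y i to V changes f by at least min d |Y i| in the
    direction of Y i. Off A the right side is nonnegative because f is monotone.\<close>
  have inc: "indicator A \<omega> * T i \<omega> \<le> Y i \<omega> * f (V \<omega>) - Y i \<omega> * f (V \<omega> - Y i \<omega>)" for i \<omega>
  proof -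
    let ?y = "Y i \<omega>" and ?v = "V \<omega>"
    have nn: "0 \<le> ?y * (f ?v - f (?v - ?y))"
    proof (cases "0 \<le> ?y")
      case True
      then show ?thesis using f_mono[of "?v - ?y" ?v] by simp
    next
      case False
      then show ?thesis using f_mono[of ?v "?v - ?y"] by (intro mult_nonpos_nonpos) auto
    qed
    show ?thesis
    proof (cases "\<omega> \<in> A")
      case True
      then have v: "a \<le> ?v" "?v \<le> b" by (auto simp: A_def)
      show ?thesis
      proof (cases "0 \<le> ?y")
        case y: True
        have "min d ?y \<le> f ?v - f (?v - ?y)"
          using v y \<open>0 < d\<close> by (auto simp: f_def max_def min_def)
        from mult_left_mono[OF this y] show ?thesis
          using True y by (simp add: T_def algebra_simps)
      next
        case y: False
        have "min d (- ?y) \<le> f (?v - ?y) - f ?v"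
          using v y \<open>0 < d\<close> by (auto simp: f_def max_def min_def)
        from mult_left_mono[OF this, of "- ?y"] y show ?thesis
          using True by (simp add: T_def algebra_simps)
      qed
    next
      case False
      then show ?thesis using nn by (simp add: algebra_simps)
    qed
  qed
  have intAT: "integrable M (\<lambda>\<omega>. indicator A \<omega> * T i \<omega>)" if "i \<in> J" for i
    using integrable_mult_bounded[OF intT[OF that], of "indicator A" 1] by (simp add: mult.commute)
  have intAU: "integrable M (\<lambda>\<omega>. indicator A \<omega> * U \<omega>)"
    using integrable_mult_bounded[OF intU, of "indicator A" 1] by (simp add: mult.commute)
  have "expectation (\<lambda>\<omega>. indicator A \<omega> * U \<omega>) = (\<Sum>i\<in>J. expectation (\<lambda>\<omega>. indicator A \<omega> * T i \<omega>))"
    unfolding U_def sum_distrib_left using intAT by (subst Bochner_Integration.integral_sum) auto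
  also have "\<dots> \<le> (\<Sum>i\<in>J. expectation (\<lambda>\<omega>. Y i \<omega> * f (V \<omega>)))"
  proof (rule sum_mono)
    fix i assume i: "i \<in> J"
    have "expectation (\<lambda>\<omega>. indicator A \<omega> * T i \<omega>)
        \<le> expectation (\<lambda>\<omega>. Y i \<omega> * f (V \<omega>) - Y i \<omega> * f (V \<omega> - Y i \<omega>))"
      using intAT[OF i] intYf[OF i] intYf'[OF i] inc by (intro integral_mono) auto
    also have "\<dots> = expectation (\<lambda>\<omega>. Y i \<omega> * f (V \<omega>))"
      using intYf[OF i] intYf'[OF i] eYf'[OF i] by simp
    finally show "expectation (\<lambda>\<omega>. indicator A \<omega> * T i \<omega>) \<le> expectation (\<lambda>\<omega>. Y i \<omega> * f (V \<omega>))" .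
  qed
  also have "\<dots> = expectation (\<lambda>\<omega>. V \<omega> * f (V \<omega>))"
  proof -
    have "expectation (\<lambda>\<omega>. V \<omega> * f (V \<omega>)) = expectation (\<lambda>\<omega>. \<Sum>i\<in>J. Y i \<omega> * f (V \<omega>))"
      by (rule arg_cong[where f=expectation]) (simp add: V_def sum_distrib_right)
    then show ?thesis using intYf by (subst (asm) Bochner_Integration.integral_sum) auto
  qed
  also have "\<dots> \<le> expectation (\<lambda>\<omega>. ((b - a) / 2 + d) * \<bar>V \<omega>\<bar>)"
  proof (rule integral_mono)
    have intV: "integrable M V" unfolding V_def using int by (intro Bochner_Integration.integrable_sum)
    then show "integrable M (\<lambda>\<omega>. ((b - a) / 2 + d) * \<bar>V \<omega>\<bar>)" by simp
    show "integrable M (\<lambda>\<omega>. V \<omega> * f (V \<omega>))"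
      using intV f_bound by (intro integrable_mult_bounded[where C="(b - a) / 2 + d"]) auto
    show "V \<omega> * f (V \<omega>) \<le> ((b - a) / 2 + d) * \<bar>V \<omega>\<bar>" for \<omega>
    proof -
      have "V \<omega> * f (V \<omega>) \<le> \<bar>V \<omega>\<bar> * \<bar>f (V \<omega>)\<bar>" by (metis abs_ge_self abs_mult)
      also have "\<dots> \<le> \<bar>V \<omega>\<bar> * ((b - a) / 2 + d)" by (intro mult_left_mono f_bound) simp
      finally show ?thesis by (simp add: mult.commute)
    qed
  qed
  also have "\<dots> \<le> ((b - a) / 2 + d) * 1"
  proof -
    have "expectation (\<lambda>\<omega>. \<bar>V \<omega>\<bar>) \<le> 1"
      using integrable_indep_sum_square[OF fin ind sq mean] expectation_indep_sum_square[OF fin ind sq mean] var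
      by (intro expectation_abs_le) (auto simp: V_def)
    from mult_left_mono[OF this, of "(b - a) / 2 + d"] show ?thesis
      using \<open>a \<le> b\<close> \<open>0 < d\<close> by simp
  qed
  finally have upper: "expectation (\<lambda>\<omega>. indicator A \<omega> * U \<omega>) \<le> (b - a) / 2 + d" by simp
  define \<mu> where "\<mu> = expectation U"
  have \<mu>: "\<mu> = (\<Sum>i\<in>J. expectation (T i))"
    unfolding \<mu>_def U_def using intT by (subst Bochner_Integration.integral_sum) auto
  \<comment> \<open>U is a sum of independent terms with T i \<le> d |Y i|, so its variance is at
    most d^2 times the total variance of the Y i.\<close>
  have dev: "expectation (\<lambda>\<omega>. \<bar>U \<omega> - \<mu>\<bar>) \<le> d"
  proof -
    define Z where "Z i \<omega> = T i \<omega> - expectation (T i)" for i \<omega>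
    have Uz: "U \<omega> - \<mu> = (\<Sum>i\<in>J. Z i \<omega>)" for \<omega>
      by (simp add: U_def \<mu> Z_def sum_subtractf)
    have sqT: "integrable M (\<lambda>\<omega>. (T i \<omega>)\<^sup>2)" and sqT_le: "expectation (\<lambda>\<omega>. (T i \<omega>)\<^sup>2) \<le> d\<^sup>2 * expectation (\<lambda>\<omega>. (Y i \<omega>)\<^sup>2)"
      if "i \<in> J" for i
    proof -
      have le: "(T i \<omega>)\<^sup>2 \<le> d\<^sup>2 * (Y i \<omega>)\<^sup>2" for \<omega>
      proof -
        have "(min d \<bar>Y i \<omega>\<bar>)\<^sup>2 \<le> d\<^sup>2" using \<open>0 < d\<close> by (intro power_mono) auto
        from mult_left_mono[OF this, of "(Y i \<omega>)\<^sup>2"] show ?thesis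
          by (simp add: T_def power_mult_distrib mult.commute)
      qed
      show 1: "integrable M (\<lambda>\<omega>. (T i \<omega>)\<^sup>2)"
        by (rule Bochner_Integration.integrable_bound[of _ "\<lambda>\<omega>. d\<^sup>2 * (Y i \<omega>)\<^sup>2"]) (use sq that le in auto)
      have "expectation (\<lambda>\<omega>. (T i \<omega>)\<^sup>2) \<le> expectation (\<lambda>\<omega>. d\<^sup>2 * (Y i \<omega>)\<^sup>2)"
        using 1 sq[OF that] le by (intro integral_mono) auto
      then show "expectation (\<lambda>\<omega>. (T i \<omega>)\<^sup>2) \<le> d\<^sup>2 * expectation (\<lambda>\<omega>. (Y i \<omega>)\<^sup>2)" by simp
    qed
    have indZ: "indep_vars (\<lambda>_. borel) Z J"
      unfolding Z_def T_def
      by (rule indep_vars_compose2[OF ind, where Y="\<lambda>i y. \<bar>y\<bar> * min d \<bar>y\<bar> - expectation (\<lambda>\<omega>. \<bar>Y i \<omega>\<bar> * min d \<bar>Y i \<omega>\<bar>)"]) auto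
    have sqZ: "integrable M (\<lambda>\<omega>. (Z i \<omega>)\<^sup>2)" if "i \<in> J" for i
      unfolding Z_def power2_diff using sqT[OF that] intT[OF that] by simp
    have meanZ: "expectation (Z i) = 0" if "i \<in> J" for i
      unfolding Z_def using intT[OF that] by (simp add: prob_space)
    have "(\<Sum>i\<in>J. expectation (\<lambda>\<omega>. (Z i \<omega>)\<^sup>2)) \<le> (\<Sum>i\<in>J. d\<^sup>2 * expectation (\<lambda>\<omega>. (Y i \<omega>)\<^sup>2))"
    proof (rule sum_mono)
      fix i assume i: "i \<in> J"
      have "expectation (\<lambda>\<omega>. (Z i \<omega>)\<^sup>2) = expectation (\<lambda>\<omega>. (T i \<omega>)\<^sup>2) - (expectation (T i))\<^sup>2"
        unfolding Z_def by (rule variance_eq[OF intT[OF i] sqT[OF i]])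
      also have "\<dots> \<le> expectation (\<lambda>\<omega>. (T i \<omega>)\<^sup>2)" by simp
      also note sqT_le[OF i]
      finally show "expectation (\<lambda>\<omega>. (Z i \<omega>)\<^sup>2) \<le> d\<^sup>2 * expectation (\<lambda>\<omega>. (Y i \<omega>)\<^sup>2)" .
    qed
    also have "\<dots> \<le> d\<^sup>2" unfolding sum_distrib_left[symmetric]
      using mult_left_mono[OF var, of "d\<^sup>2"] by simp
    finally show ?thesis
      using integrable_indep_sum_square[OF fin indZ sqZ meanZ] expectation_indep_sum_square[OF fin indZ sqZ meanZ] \<open>0 < d\<close>
      by (intro expectation_abs_le) (auto simp: Uz[symmetric])
  qed
  have "\<mu> * prob A - d / 2 \<le> expectation (\<lambda>\<omega>. indicator A \<omega> * U \<omega>)"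
  proof -
    \<comment> \<open>Replacing U by its mean on A loses at most the negative part (|U - \<mu>| - (U
      - \<mu>)) / 2. As U - \<mu> has mean zero, this costs d / 2 rather than d, hence 3/2 d in
      total.\<close>
    have "expectation (\<lambda>\<omega>. \<mu> * indicator A \<omega> - \<bar>U \<omega> - \<mu>\<bar> / 2 + (U \<omega> - \<mu>) / 2) \<le> expectation (\<lambda>\<omega>. indicator A \<omega> * U \<omega>)"
    proof (rule integral_mono)
      show "integrable M (\<lambda>\<omega>. \<mu> * indicator A \<omega> - \<bar>U \<omega> - \<mu>\<bar> / 2 + (U \<omega> - \<mu>) / 2)"
        using intU by (simp add: integrable_indicator_iff emeasure_eq_measure)
      show "\<mu> * indicator A \<omega> - \<bar>U \<omega> - \<mu>\<bar> / 2 + (U \<omega> - \<mu>) / 2 \<le> indicator A \<omega> * U \<omega>" for \<omega>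
        by (auto simp: indicator_def abs_if field_simps)
    qed (rule intAU)
    also have "expectation (\<lambda>\<omega>. \<mu> * indicator A \<omega> - \<bar>U \<omega> - \<mu>\<bar> / 2 + (U \<omega> - \<mu>) / 2)
        = \<mu> * prob A - expectation (\<lambda>\<omega>. \<bar>U \<omega> - \<mu>\<bar>) / 2"
      using intU by (simp add: prob_space \<mu>_def[symmetric] emeasure_eq_measure)
    finally show ?thesis using dev by linarith
  qed
  with upper have "\<mu> * prob A \<le> (b - a) / 2 + 3 / 2 * d" by linarith
  moreover have "m * prob A \<le> \<mu> * prob A"
    using mu by (intro mult_right_mono) (auto simp: \<mu> T_def[abs_def])
  ultimately show ?thesis by (simp add: A_def V_def)
qed

end

subsection \<open>Normal approximation of interval probabilities\<close>

lemma set_integrable_bounded_Icc: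
  fixes f :: "real \<Rightarrow> real"
  assumes [measurable]: "f \<in> borel_measurable borel" and "\<And>x. \<bar>f x\<bar> \<le> C"
  shows "set_integrable lborel {a..b} f"
  unfolding set_integrable_def
proof (rule Bochner_Integration.integrable_bound)
  show "integrable lborel (\<lambda>x. indicator {a..b} x *\<^sub>R C)"
    by (intro integrable_scaleR_left) (simp add: integrable_indicator_iff emeasure_lborel_Icc_eq)
  show "AE x in lborel. norm (indicator {a..b} x *\<^sub>R f x) \<le> norm (indicator {a..b} x *\<^sub>R C)"
    using order_trans[OF assms(2) abs_ge_self] by (intro AE_I2) (auto simp: indicator_def)
qed measurable

context prob_space begin

text \<open>By independence the joint law is a product, so Fubini freezes X and averages over V
  alone.\<close>

lemma indep_var_expectation:
  fixes k :: "real \<Rightarrow> real \<Rightarrow> real"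
  assumes ind: "indep_var borel X borel V"
    and [measurable]: "case_prod k \<in> borel_measurable (borel \<Otimes>\<^sub>M borel)"
    and int: "integrable M (\<lambda>\<omega>. k (X \<omega>) (V \<omega>))"
  shows "expectation (\<lambda>\<omega>. k (X \<omega>) (V \<omega>)) = expectation (\<lambda>\<omega>. expectation (\<lambda>\<omega>'. k (X \<omega>) (V \<omega>')))"
proof -
  have [measurable]: "random_variable borel X" "random_variable borel V"
    using indep_var_rv1[OF ind] indep_var_rv2[OF ind] .
  have prod: "distr M borel X \<Otimes>\<^sub>M distr M borel V = distr M (borel \<Otimes>\<^sub>M borel) (\<lambda>\<omega>. (X \<omega>, V \<omega>))"
    using ind by (simp add: indep_var_distribution_eq)
  interpret X: prob_space "distr M borel X" by (rule prob_space_distr) simp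
  interpret V: prob_space "distr M borel V" by (rule prob_space_distr) simp
  interpret P: pair_prob_space "distr M borel X" "distr M borel V" ..
  have intk: "integrable (distr M borel X \<Otimes>\<^sub>M distr M borel V) (case_prod k)"
    unfolding prod using int by (subst integrable_distr_eq) auto
  have inner: "(\<integral>v. k x v \<partial>distr M borel V) = expectation (\<lambda>\<omega>'. k x (V \<omega>'))" for x
    by (rule integral_distr) measurable
  have [measurable]: "(\<lambda>x. expectation (\<lambda>\<omega>'. k x (V \<omega>'))) \<in> borel_measurable borel" by measurable
  have "expectation (\<lambda>\<omega>. k (X \<omega>) (V \<omega>)) = (\<integral>p. case_prod k p \<partial>(distr M borel X \<Otimes>\<^sub>M distr M borel V))"
    unfolding prod by (subst integral_distr) auto
  also have "\<dots> = (\<integral>x. (\<integral>v. k x v \<partial>distr M borel V) \<partial>distr M borel X)"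
    using P.integral_fst'[OF intk] by simp
  also have "\<dots> = expectation (\<lambda>\<omega>. expectation (\<lambda>\<omega>'. k (X \<omega>) (V \<omega>')))"
    unfolding inner by (subst integral_distr) auto
  finally show "expectation (\<lambda>\<omega>. k (X \<omega>) (V \<omega>)) = expectation (\<lambda>\<omega>. expectation (\<lambda>\<omega>'. k (X \<omega>) (V \<omega>')))" .
qed

text \<open>Put s = |y| + |t|. By the Stein equation the increment is that of w f(w), in mean at
  most min 1 (2.3 s) with 2.3 = 1 + 1.3, plus a change of the indicator, which the concentration
  hypothesis bounds by min 1 (s + \<kappa>). The caps add up to 2 and the slopes to 3.3.\<close>

lemma expectation_stein_int_deriv_diff:
  assumes [measurable]: "random_variable borel V"
    and int: "integrable M V" and abs: "expectation (\<lambda>\<omega>. \<bar>V \<omega>\<bar>) \<le> 1" and "0 \<le> \<kappa>"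
    and conc: "\<And>a b. a \<le> b \<Longrightarrow> prob {\<omega> \<in> space M. a \<le> V \<omega> \<and> V \<omega> \<le> b} \<le> b - a + \<kappa>"
    and "a \<le> b"
  shows "\<bar>expectation (\<lambda>\<omega>. stein_int_deriv a b (V \<omega> + y)) - expectation (\<lambda>\<omega>. stein_int_deriv a b (V \<omega> + t))\<bar>
           \<le> min 2 (3.3 * \<bar>y\<bar>) + min 2 (3.3 * \<bar>t\<bar>) + \<kappa>"
proof -
  have *: "\<bar>expectation (\<lambda>\<omega>. stein_int_deriv a b (V \<omega> + y)) - expectation (\<lambda>\<omega>. stein_int_deriv a b (V \<omega> + t))\<bar>
           \<le> min 2 (3.3 * \<bar>y\<bar>) + min 2 (3.3 * \<bar>t\<bar>) + \<kappa>" if "t \<le> y" for t y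
  proof -
    define s where "s = \<bar>t\<bar> + \<bar>y\<bar>"
    define G where "G \<omega> = min 1 ((\<bar>V \<omega>\<bar> + 1.3) * s)" for \<omega>
    \<comment> \<open>This is the event that c lies between V + t and V + y.\<close>
    define P where "P c = {\<omega> \<in> space M. c - y \<le> V \<omega> \<and> V \<omega> \<le> c - t}" for c
    have [measurable]: "P c \<in> events" for c unfolding P_def by measurable
    have s: "0 \<le> s" by (simp add: s_def)
    have [measurable]: "random_variable borel G" unfolding G_def by measurable
    have intG: "integrable M G"
      using s by (intro integrable_const_bound[where B=1]) (auto simp: G_def)
    have EG: "expectation G \<le> min 1 (2.3 * s)"
    proof -
      have "expectation G \<le> expectation (\<lambda>_. 1 :: real)"
        using intG by (intro integral_mono) (auto simp: G_def)
      moreover have "expectation G \<le> expectation (\<lambda>\<omega>. (\<bar>V \<omega>\<bar> + 1.3) * s)"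
        using intG int by (intro integral_mono) (auto simp: G_def)
      moreover have "expectation (\<lambda>\<omega>. (\<bar>V \<omega>\<bar> + 1.3) * s) = (expectation (\<lambda>\<omega>. \<bar>V \<omega>\<bar>) + 1.3) * s"
        using int by (subst integral_mult_left_zero) (simp add: prob_space)
      moreover have "(expectation (\<lambda>\<omega>. \<bar>V \<omega>\<bar>) + 1.3) * s \<le> 2.3 * s"
        using abs s by (intro mult_right_mono) auto
      moreover have "expectation (\<lambda>_. 1 :: real) = 1" by (simp add: prob_space)
      ultimately show ?thesis by linarith
    qed
    have EP: "prob (P c) \<le> min 1 (s + \<kappa>)" for c
    proof -
      have "prob (P c) \<le> (c - t) - (c - y) + \<kappa>"
        unfolding P_def using that by (intro conc) simp
      also have "\<dots> \<le> s + \<kappa>" by (simp add: s_def)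
      finally show ?thesis by simp
    qed
    have g: "\<bar>(V \<omega> + y) * stein_int a b (V \<omega> + y) - (V \<omega> + t) * stein_int a b (V \<omega> + t)\<bar> \<le> G \<omega>" for \<omega>
      using stein_sol_mult_increment[OF that, of "V \<omega>" a] stein_sol_mult_increment[OF that, of "V \<omega>" b]
      unfolding G_def s_def stein_int_def by (simp only: right_diff_distrib abs_le_iff) linarith
    \<comment> \<open>As t \<le> y, the shift can enter [a, b] only across a and leave it only
      across b, so each direction costs a single event.\<close>
    have ind: "indicator {a..b} (V \<omega> + y) - indicator {a..b} (V \<omega> + t) \<le> (indicator (P a) \<omega> :: real)"
      "- (indicator (P b) \<omega> :: real) \<le> indicator {a..b} (V \<omega> + y) - indicator {a..b} (V \<omega> + t)" if "\<omega> \<in> space M" for \<omega>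
      using \<open>t \<le> y\<close> \<open>a \<le> b\<close> that by (auto simp: indicator_def P_def)
    let ?D = "\<lambda>\<omega>. stein_int_deriv a b (V \<omega> + y) - stein_int_deriv a b (V \<omega> + t)"
    have intd: "integrable M (\<lambda>\<omega>. stein_int_deriv a b (V \<omega> + r))" for r
      using abs_stein_int_deriv_le[of a b] by (intro integrable_const_bound[where B=4]) auto
    have intP: "integrable M (indicator (P c) :: 'a \<Rightarrow> real)" for c
      by (simp add: integrable_indicator_iff emeasure_eq_measure)
    have EIP: "expectation (indicator (P c) :: 'a \<Rightarrow> real) = prob (P c)" for c by simp
    have "expectation ?D \<le> expectation (\<lambda>\<omega>. G \<omega> + indicator (P a) \<omega>)"
    proof (rule integral_mono)
      show "?D \<omega> \<le> G \<omega> + indicator (P a) \<omega>" if "\<omega> \<in> space M" for \<omega>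
        using g[of \<omega>] ind(1)[OF that] unfolding stein_int_deriv_def abs_le_iff by linarith
    qed (intro Bochner_Integration.integrable_diff Bochner_Integration.integrable_add intd intG intP)+
    also have "\<dots> = expectation G + prob (P a)" using intG intP[of a] EIP[of a] by simp
    finally have up: "expectation ?D \<le> expectation G + prob (P a)" .
    have "expectation (\<lambda>\<omega>. - G \<omega> - indicator (P b) \<omega>) \<le> expectation ?D"
    proof (rule integral_mono)
      show "- G \<omega> - indicator (P b) \<omega> \<le> ?D \<omega>" if "\<omega> \<in> space M" for \<omega>
        using g[of \<omega>] ind(2)[OF that] unfolding stein_int_deriv_def abs_le_iff by linarith
    qed (intro Bochner_Integration.integrable_diff Bochner_Integration.integrable_minus intd intG intP)+
    also have "expectation (\<lambda>\<omega>. - G \<omega> - indicator (P b) \<omega>) = - expectation G - prob (P b)"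
      using intG intP[of b] EIP[of b] by simp
    finally have lo: "- expectation G - prob (P b) \<le> expectation ?D" .
    have "expectation ?D = expectation (\<lambda>\<omega>. stein_int_deriv a b (V \<omega> + y)) - expectation (\<lambda>\<omega>. stein_int_deriv a b (V \<omega> + t))"
      by (rule Bochner_Integration.integral_diff[OF intd intd])
    with up lo have "\<bar>expectation (\<lambda>\<omega>. stein_int_deriv a b (V \<omega> + y)) - expectation (\<lambda>\<omega>. stein_int_deriv a b (V \<omega> + t))\<bar>
        \<le> min 1 (2.3 * s) + min 1 (s + \<kappa>)"
      using EG EP[of a] EP[of b] unfolding abs_le_iff by linarith
    also have "\<dots> \<le> min 2 (3.3 * s) + \<kappa>"
      using \<open>0 \<le> \<kappa>\<close> by linarith
    also have "\<dots> \<le> min 2 (3.3 * \<bar>y\<bar>) + min 2 (3.3 * \<bar>t\<bar>) + \<kappa>"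
    proof -
      have "min 2 (3.3 * (p + r)) \<le> min 2 (3.3 * r) + min 2 (3.3 * p)" if "0 \<le> p" "0 \<le> r" for p r :: real
        using that by (auto simp: min_def)
      then show ?thesis unfolding s_def by (intro add_right_mono) simp
    qed
    finally show ?thesis .
  qed
  show ?thesis
  proof (cases "t \<le> y")
    case False
    then show ?thesis using *[of y t] by (simp add: abs_minus_commute add.commute add.left_commute)
  qed (rule *)
qed

text \<open>Both expectations being compared are \<open>X\<^sup>2\<close>-weighted averages of
  \<open>\<phi> s = expectation (\<lambda>\<omega>. stein_int_deriv a b (V \<omega> + s))\<close>: the first over \<open>s\<close> between \<open>0\<close> and \<open>X\<close>, the
  second over \<open>s\<close> distributed as an independent copy of \<open>X\<close>.\<close>

lemma stein_summand:
  assumes ind: "indep_var borel X borel V"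
    and sqX: "integrable M (\<lambda>\<omega>. (X \<omega>)\<^sup>2)" and mean: "expectation X = 0"
    and int: "integrable M V" and abs: "expectation (\<lambda>\<omega>. \<bar>V \<omega>\<bar>) \<le> 1" and "0 \<le> \<kappa>"
    and conc: "\<And>a b. a \<le> b \<Longrightarrow> prob {\<omega> \<in> space M. a \<le> V \<omega> \<and> V \<omega> \<le> b} \<le> b - a + \<kappa>"
    and "a \<le> b"
  shows "\<bar>expectation (\<lambda>\<omega>. X \<omega> * stein_int a b (V \<omega> + X \<omega>))
            - expectation (\<lambda>\<omega>. (X \<omega>)\<^sup>2) * expectation (\<lambda>\<omega>. stein_int_deriv a b (V \<omega> + X \<omega>))\<bar>
         \<le> expectation (\<lambda>\<omega>. (X \<omega>)\<^sup>2 * min 2 (1.65 * \<bar>X \<omega>\<bar>))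
            + expectation (\<lambda>\<omega>. (X \<omega>)\<^sup>2) * (expectation (\<lambda>\<omega>. min 2 (3.3 * \<bar>X \<omega>\<bar>)) + \<kappa>)"
proof -
  define f where "f = stein_int a b"
  define f' where "f' = stein_int_deriv a b"
  define \<psi> where "\<psi> s = expectation (\<lambda>\<omega>. f (V \<omega> + s))" for s
  define \<phi> where "\<phi> s = expectation (\<lambda>\<omega>. f' (V \<omega> + s))" for s
  let ?v = "expectation (\<lambda>\<omega>. (X \<omega>)\<^sup>2)"
  have rvX [measurable]: "random_variable borel X" and rvV [measurable]: "random_variable borel V"
    using indep_var_rv1[OF ind] indep_var_rv2[OF ind] .
  have [measurable]: "f \<in> borel_measurable borel" "f' \<in> borel_measurable borel"
    by (simp_all add: f_def f'_def)
  have [measurable]: "\<psi> \<in> borel_measurable borel" "\<phi> \<in> borel_measurable borel"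
    unfolding \<psi>_def[abs_def] \<phi>_def[abs_def] by measurable
  have f_le: "\<bar>f w\<bar> \<le> 1.3" and f'_le: "\<bar>f' w\<bar> \<le> 4" for w
    unfolding f_def f'_def by (rule abs_stein_int_le abs_stein_int_deriv_le)+
  have intf: "integrable M (\<lambda>\<omega>. f (V \<omega> + s))" and intf': "integrable M (\<lambda>\<omega>. f' (V \<omega> + s))" for s
    using f_le f'_le by (auto intro!: integrable_const_bound[where B="1.3" and f="\<lambda>\<omega>. f (V \<omega> + s)"]
        integrable_const_bound[where B=4 and f="\<lambda>\<omega>. f' (V \<omega> + s)"])
  have intX: "integrable M X" by (rule square_integrable_imp_integrable[OF rvX sqX])
  have \<phi>_diff: "\<bar>\<phi> y - \<phi> t\<bar> \<le> min 2 (3.3 * \<bar>y\<bar>) + min 2 (3.3 * \<bar>t\<bar>) + \<kappa>" for y t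
    unfolding \<phi>_def f'_def by (rule expectation_stein_int_deriv_diff[OF rvV int abs \<open>0 \<le> \<kappa>\<close> conc \<open>a \<le> b\<close>])
  have \<phi>_le: "\<bar>\<phi> s\<bar> \<le> 4" and \<psi>_le: "\<bar>\<psi> s\<bar> \<le> 1.3" for s
  proof -
    have "\<bar>\<phi> s\<bar> \<le> expectation (\<lambda>\<omega>. \<bar>f' (V \<omega> + s)\<bar>)" unfolding \<phi>_def by (rule integral_abs_bound)
    also have "\<dots> \<le> expectation (\<lambda>\<omega>. 4)" using intf' f'_le by (intro integral_mono) auto
    finally show "\<bar>\<phi> s\<bar> \<le> 4" by (simp add: prob_space)
    have "\<bar>\<psi> s\<bar> \<le> expectation (\<lambda>\<omega>. \<bar>f (V \<omega> + s)\<bar>)" unfolding \<psi>_def by (rule integral_abs_bound)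
    also have "\<dots> \<le> expectation (\<lambda>\<omega>. 1.3)" using intf f_le by (intro integral_mono) auto
    finally show "\<bar>\<psi> s\<bar> \<le> 1.3" by (simp add: prob_space)
  qed
  \<comment> \<open>Fubini averages the pointwise increment formula for f over V, so that
    \<open>\<phi>\<close> acts as the derivative of \<open>\<psi>\<close>. Lebesgue measure
    restricted to [0, 1] provides the finite factor of the product.\<close>
  have \<psi>_incr: "((\<lambda>u. x * \<phi> (u * x)) has_integral (\<psi> x - \<psi> 0)) {0..1}" for x
  proof -
    define I where "I = restrict_space lborel {0..1::real}"
    have fin: "finite_measure I"
      unfolding I_def by (intro finite_measureI) (simp add: emeasure_restrict_space space_restrict_space)
    have [measurable]: "(\<lambda>u. u) \<in> borel_measurable I"
      unfolding I_def by (intro measurable_restrict_space1) simp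
    have [measurable]: "(\<lambda>p. fst p) \<in> borel_measurable (I \<Otimes>\<^sub>M M)"
      using measurable_compose[OF measurable_fst, of "\<lambda>u. u" I borel] by simp
    interpret I: finite_measure I by (rule fin)
    interpret P: pair_sigma_finite I M ..
    interpret Q: finite_measure "I \<Otimes>\<^sub>M M"
      by (rule finite_measure_pair_measure) unfold_locales
    have int: "integrable (I \<Otimes>\<^sub>M M) (\<lambda>(u, \<omega>). x * f' (V \<omega> + u * x))"
    proof (rule Q.integrable_const_bound[where B="\<bar>x\<bar> * 4"])
      show "AE p in I \<Otimes>\<^sub>M M. norm (case p of (u, \<omega>) \<Rightarrow> x * f' (V \<omega> + u * x)) \<le> \<bar>x\<bar> * 4"
        using f'_le by (intro AE_I2) (auto simp: abs_mult split: prod.split intro!: mult_left_mono)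
    qed measurable
    have swap: "(\<integral>\<omega>. (\<integral>u. x * f' (V \<omega> + u * x) \<partial>I) \<partial>M) = (\<integral>u. (\<integral>\<omega>. x * f' (V \<omega> + u * x) \<partial>M) \<partial>I)"
      using P.Fubini_integral[OF int] by simp
    have inner: "(\<integral>u. x * f' (V \<omega> + u * x) \<partial>I) = f (V \<omega> + x) - f (V \<omega>)" for \<omega>
    proof -
      have si: "set_integrable lborel {0..1} (\<lambda>u. x * f' (V \<omega> + u * x))"
        using f'_le by (intro set_integrable_bounded_Icc[where C="\<bar>x\<bar> * 4"]) (auto simp: abs_mult intro!: mult_left_mono)
      have "(\<integral>u. x * f' (V \<omega> + u * x) \<partial>I) = (LINT u:{0..1}|lborel. x * f' (V \<omega> + u * x))"
        unfolding I_def set_lebesgue_integral_def by (subst integral_restrict_space) auto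
      also have "\<dots> = integral {0..1} (\<lambda>u. x * f' (V \<omega> + u * x))"
        by (rule set_borel_integral_eq_integral(2)[OF si])
      also have "\<dots> = f (V \<omega> + x) - f (V \<omega>)"
        unfolding f_def f'_def by (rule integral_unique[OF stein_int_increment[OF \<open>a \<le> b\<close>]])
      finally show ?thesis .
    qed
    have incr: "(\<integral>\<omega>. f (V \<omega> + x) - f (V \<omega>) \<partial>M) = \<psi> x - \<psi> 0"
      using intf[of x] intf[of 0] by (simp add: \<psi>_def)
    have eq: "\<psi> x - \<psi> 0 = (\<integral>u. x * \<phi> (u * x) \<partial>I)"
      using swap unfolding inner incr by (simp only: \<phi>_def integral_mult_right_zero)
    have si: "set_integrable lborel {0..1} (\<lambda>u. x * \<phi> (u * x))"
      using \<phi>_le by (intro set_integrable_bounded_Icc[where C="\<bar>x\<bar> * 4"]) (auto simp: abs_mult intro!: mult_left_mono)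
    have set_eq: "\<psi> x - \<psi> 0 = (LINT u:{0..1}|lborel. x * \<phi> (u * x))"
      unfolding eq I_def set_lebesgue_integral_def by (subst integral_restrict_space) auto
    show ?thesis
      unfolding has_integral_iff
      by (rule conjI, rule set_borel_integral_eq_integral(1)[OF si])
        (rule trans[OF set_borel_integral_eq_integral(2)[OF si, symmetric] set_eq[symmetric]])
  qed
  \<comment> \<open>The left side is x^2 times an average over u in [0, 1] of \<phi>(u x) -
    \<phi>(y), in absolute value. Averaging 3.3 |x| u gives 1.65 |x|, while the cap 2 is
    kept.\<close>
  have local: "\<bar>x * (\<psi> x - \<psi> 0) - x\<^sup>2 * \<phi> y\<bar> \<le> x\<^sup>2 * min 2 (1.65 * \<bar>x\<bar>) + x\<^sup>2 * (min 2 (3.3 * \<bar>y\<bar>) + \<kappa>)" for x y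
  proof -
    define c where "c = min 2 (3.3 * \<bar>y\<bar>) + \<kappa>"
    have I1: "((\<lambda>u. x * \<phi> (u * x) - x * \<phi> y) has_integral (\<psi> x - \<psi> 0 - x * \<phi> y)) {0..1}"
      using has_integral_diff[OF \<psi>_incr has_integral_const_real[of "x * \<phi> y" 0 1]] by simp
    have b: "norm (x * \<phi> (u * x) - x * \<phi> y) \<le> \<bar>x\<bar> * (2 + c)"
      "norm (x * \<phi> (u * x) - x * \<phi> y) \<le> \<bar>x\<bar> * (3.3 * \<bar>x\<bar> * u + c)" if "u \<in> {0..1}" for u
    proof -
      have "norm (x * \<phi> (u * x) - x * \<phi> y) = \<bar>x\<bar> * \<bar>\<phi> (u * x) - \<phi> y\<bar>"
        by (simp add: right_diff_distrib[symmetric] abs_mult)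
      moreover have "\<bar>\<phi> (u * x) - \<phi> y\<bar> \<le> min 2 (3.3 * \<bar>x\<bar> * u) + c"
        using \<phi>_diff[of "u * x" y] that by (simp add: c_def abs_mult mult_ac)
      then have "\<bar>\<phi> (u * x) - \<phi> y\<bar> \<le> 2 + c" "\<bar>\<phi> (u * x) - \<phi> y\<bar> \<le> 3.3 * \<bar>x\<bar> * u + c"
        by linarith+
      ultimately show "norm (x * \<phi> (u * x) - x * \<phi> y) \<le> \<bar>x\<bar> * (2 + c)"
        "norm (x * \<phi> (u * x) - x * \<phi> y) \<le> \<bar>x\<bar> * (3.3 * \<bar>x\<bar> * u + c)"
        by (simp_all only: mult_left_mono abs_ge_zero)
    qed
    have I0: "((\<lambda>u::real. \<bar>x\<bar> * (2 + c)) has_integral \<bar>x\<bar> * (2 + c)) {0..1}"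
      using has_integral_const_real[of "\<bar>x\<bar> * (2 + c)" 0 1] by simp
    from integral_norm_bound_integral[OF has_integral_integrable[OF I1] has_integral_integrable[OF I0] b(1)]
    have 1: "\<bar>\<psi> x - \<psi> 0 - x * \<phi> y\<bar> \<le> \<bar>x\<bar> * (2 + c)"
      using integral_unique[OF I1] integral_unique[OF I0] by simp
    have I2: "((\<lambda>u. \<bar>x\<bar> * (3.3 * \<bar>x\<bar> * u + c)) has_integral
        \<bar>x\<bar> * (3.3 * \<bar>x\<bar> * (1\<^sup>2 / 2) + c * 1) - \<bar>x\<bar> * (3.3 * \<bar>x\<bar> * (0\<^sup>2 / 2) + c * 0)) {0..1}"
      by (rule fundamental_theorem_of_calculus)
         (auto intro!: derivative_eq_intros simp: has_real_derivative_iff_has_vector_derivative[symmetric] algebra_simps)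
    from integral_norm_bound_integral[OF has_integral_integrable[OF I1] has_integral_integrable[OF I2] b(2)]
    have 2: "\<bar>\<psi> x - \<psi> 0 - x * \<phi> y\<bar> \<le> \<bar>x\<bar> * (1.65 * \<bar>x\<bar> + c)"
      unfolding integral_unique[OF I1] integral_unique[OF I2] by simp
    have "\<bar>\<psi> x - \<psi> 0 - x * \<phi> y\<bar> \<le> \<bar>x\<bar> * (min 2 (1.65 * \<bar>x\<bar>) + c)"
      using 1 2 by (simp add: min_def)
    from mult_left_mono[OF this, of "\<bar>x\<bar>"]
    have "\<bar>x * (\<psi> x - \<psi> 0 - x * \<phi> y)\<bar> \<le> x\<^sup>2 * (min 2 (1.65 * \<bar>x\<bar>) + c)"
      by (simp add: abs_mult power2_eq_square mult.assoc[symmetric])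
    then show ?thesis by (simp add: c_def algebra_simps power2_eq_square)
  qed
  define A where "A = expectation (\<lambda>\<omega>. (X \<omega>)\<^sup>2 * min 2 (1.65 * \<bar>X \<omega>\<bar>))"
  define e where "e = expectation (\<lambda>\<omega>. X \<omega> * f (V \<omega> + X \<omega>))"
  have intA: "integrable M (\<lambda>\<omega>. (X \<omega>)\<^sup>2 * min 2 (1.65 * \<bar>X \<omega>\<bar>))"
    using sqX by (intro integrable_mult_bounded[where C=2]) auto
  have intX\<psi>: "integrable M (\<lambda>\<omega>. X \<omega> * \<psi> (X \<omega>))"
    using intX \<psi>_le by (intro integrable_mult_bounded[where C="1.3"]) auto
  have e: "e = expectation (\<lambda>\<omega>. X \<omega> * \<psi> (X \<omega>))"
  proof -
    have "integrable M (\<lambda>\<omega>. X \<omega> * f (V \<omega> + X \<omega>))"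
      using intX f_le by (intro integrable_mult_bounded[where C="1.3"]) auto
    then have "e = expectation (\<lambda>\<omega>. expectation (\<lambda>\<omega>'. X \<omega> * f (V \<omega>' + X \<omega>)))"
      unfolding e_def by (intro indep_var_expectation[OF ind, of "\<lambda>x v. x * f (v + x)"]) auto
    then show ?thesis by (simp add: \<psi>_def)
  qed
  \<comment> \<open>X has mean zero, so the constant \<psi>(0) may be subtracted, which leaves an
    increment.\<close>
  then have e0: "e = expectation (\<lambda>\<omega>. X \<omega> * (\<psi> (X \<omega>) - \<psi> 0))"
    using intX intX\<psi> mean by (simp add: right_diff_distrib)
  have f': "expectation (\<lambda>\<omega>. f' (V \<omega> + X \<omega>)) = expectation (\<lambda>\<omega>. \<phi> (X \<omega>))"
  proof -
    have "integrable M (\<lambda>\<omega>. f' (V \<omega> + X \<omega>))"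
      using f'_le by (intro integrable_const_bound[where B=4]) auto
    then show ?thesis
      unfolding \<phi>_def by (intro indep_var_expectation[OF ind, of "\<lambda>x v. f' (v + x)"]) auto
  qed
  have outer: "\<bar>e - ?v * \<phi> y\<bar> \<le> A + ?v * (min 2 (3.3 * \<bar>y\<bar>) + \<kappa>)" for y
  proof -
    have i1: "integrable M (\<lambda>\<omega>. X \<omega> * (\<psi> (X \<omega>) - \<psi> 0) - (X \<omega>)\<^sup>2 * \<phi> y)"
      using intX intX\<psi> sqX by (simp add: right_diff_distrib)
    have "e - ?v * \<phi> y = expectation (\<lambda>\<omega>. X \<omega> * (\<psi> (X \<omega>) - \<psi> 0) - (X \<omega>)\<^sup>2 * \<phi> y)"
      unfolding e0 using intX intX\<psi> sqX by (simp add: right_diff_distrib)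
    also have "\<bar>\<dots>\<bar> \<le> expectation (\<lambda>\<omega>. \<bar>X \<omega> * (\<psi> (X \<omega>) - \<psi> 0) - (X \<omega>)\<^sup>2 * \<phi> y\<bar>)"
      by (rule integral_abs_bound)
    also have "\<dots> \<le> expectation (\<lambda>\<omega>. (X \<omega>)\<^sup>2 * min 2 (1.65 * \<bar>X \<omega>\<bar>) + (X \<omega>)\<^sup>2 * (min 2 (3.3 * \<bar>y\<bar>) + \<kappa>))"
      using i1 intA sqX by (intro integral_mono local) auto
    also have "\<dots> = A + ?v * (min 2 (3.3 * \<bar>y\<bar>) + \<kappa>)"
      using intA sqX by (simp add: A_def)
    finally show ?thesis .
  qed
  have int\<phi>: "integrable M (\<lambda>\<omega>. \<phi> (X \<omega>))"
    using \<phi>_le by (intro integrable_const_bound[where B=4]) auto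
  have intq: "integrable M (\<lambda>\<omega>. min 2 (3.3 * \<bar>X \<omega>\<bar>))"
    by (intro integrable_const_bound[where B=2]) auto
  \<comment> \<open>The free y of \<open>outer\<close> is now averaged over the law of X, which
    turns \<phi>(y) into the mean derivative.\<close>
  have "\<bar>e - ?v * expectation (\<lambda>\<omega>. \<phi> (X \<omega>))\<bar> = \<bar>expectation (\<lambda>\<omega>. e - ?v * \<phi> (X \<omega>))\<bar>"
    using int\<phi> by (simp add: prob_space)
  also have "\<dots> \<le> expectation (\<lambda>\<omega>. \<bar>e - ?v * \<phi> (X \<omega>)\<bar>)" by (rule integral_abs_bound)
  also have "\<dots> \<le> expectation (\<lambda>\<omega>. A + ?v * (min 2 (3.3 * \<bar>X \<omega>\<bar>) + \<kappa>))"
    using int\<phi> intq by (intro integral_mono outer) auto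
  also have "\<dots> = A + ?v * (expectation (\<lambda>\<omega>. min 2 (3.3 * \<bar>X \<omega>\<bar>)) + \<kappa>)"
    using intq by (simp add: prob_space)
  finally show ?thesis
    unfolding A_def e_def f'[symmetric] f_def f'_def .
qed

text \<open>Chebyshev's association inequality: both factors are nondecreasing functions of |X|, so
  their covariance is nonnegative.\<close>

lemma expectation_min_association:
  fixes X :: "'a \<Rightarrow> real"
  assumes [measurable]: "random_variable borel X" and sq: "integrable M (\<lambda>\<omega>. (X \<omega>)\<^sup>2)" and "0 \<le> c"
  shows "expectation (\<lambda>\<omega>. (X \<omega>)\<^sup>2) * expectation (\<lambda>\<omega>. min 2 (c * \<bar>X \<omega>\<bar>)) \<le> expectation (\<lambda>\<omega>. (X \<omega>)\<^sup>2 * min 2 (c * \<bar>X \<omega>\<bar>))"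
proof -
  define v where "v = expectation (\<lambda>\<omega>. (X \<omega>)\<^sup>2)"
  define q where "q x = min 2 (c * x)" for x :: real
  define s where "s = sqrt v"
  have "0 \<le> v" by (simp add: v_def)
  then have s: "0 \<le> s" "s\<^sup>2 = v" by (simp_all add: s_def)
  have [measurable]: "q \<in> borel_measurable borel" unfolding q_def[abs_def] by measurable
  have q: "0 \<le> q \<bar>x\<bar>" "q x \<le> 2" for x using \<open>0 \<le> c\<close> by (simp_all add: q_def)
  have intq: "integrable M (\<lambda>\<omega>. q \<bar>X \<omega>\<bar>)"
    using q by (intro integrable_const_bound[where B=2]) auto
  have intXq: "integrable M (\<lambda>\<omega>. (X \<omega>)\<^sup>2 * q \<bar>X \<omega>\<bar>)"
    using sq q by (intro integrable_mult_bounded[where C=2]) auto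
  \<comment> \<open>With the pivot s = sqrt v both factors change sign at |x| = s. As X^2 - v has
    mean zero, the constant q s disappears from the expectation of the product.\<close>
  have pos: "0 \<le> (x\<^sup>2 - v) * (q \<bar>x\<bar> - q s)" for x
  proof (cases "s \<le> \<bar>x\<bar>")
    case True
    then have "s\<^sup>2 \<le> x\<^sup>2" using power_mono[OF True s(1), of 2] by simp
    moreover have "q s \<le> q \<bar>x\<bar>" using True \<open>0 \<le> c\<close> mult_left_mono[OF True] by (fastforce simp: q_def min_def)
    ultimately show ?thesis by (simp add: s(2))
  next
    case False
    then have "x\<^sup>2 \<le> s\<^sup>2" using power_mono[of "\<bar>x\<bar>" s 2] by simp
    moreover have "q \<bar>x\<bar> \<le> q s" using False \<open>0 \<le> c\<close> mult_left_mono[of "\<bar>x\<bar>" s c] by (fastforce simp: q_def min_def)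
    ultimately show ?thesis by (intro mult_nonpos_nonpos) (simp_all add: s(2))
  qed
  have "0 \<le> expectation (\<lambda>\<omega>. ((X \<omega>)\<^sup>2 - v) * (q \<bar>X \<omega>\<bar> - q s))"
    by (rule Bochner_Integration.integral_nonneg) (rule pos)
  also have "\<dots> = expectation (\<lambda>\<omega>. (X \<omega>)\<^sup>2 * q \<bar>X \<omega>\<bar> - v * q \<bar>X \<omega>\<bar> - (X \<omega>)\<^sup>2 * q s + v * q s)"
    by (rule arg_cong[where f=expectation]) (simp add: fun_eq_iff algebra_simps)
  also have "\<dots> = expectation (\<lambda>\<omega>. (X \<omega>)\<^sup>2 * q \<bar>X \<omega>\<bar>) - v * expectation (\<lambda>\<omega>. q \<bar>X \<omega>\<bar>)"
    using intXq intq sq by (simp add: prob_space v_def[symmetric])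
  finally show ?thesis by (simp add: v_def q_def)
qed

text \<open>The estimate of \<open>stein_summand\<close> is summed over i. Each index contributes
  4.95 g i + 2.5 \<gamma> v i and the variances v i sum to 1, so the total is 7.45 \<gamma>.\<close>

lemma indep_sum_normal_approx:
  fixes Y :: "'i \<Rightarrow> 'a \<Rightarrow> real"
  assumes fin: "finite J" and ind: "indep_vars (\<lambda>_. borel) Y J"
    and sq: "\<And>i. i \<in> J \<Longrightarrow> integrable M (\<lambda>\<omega>. (Y i \<omega>)\<^sup>2)"
    and mean: "\<And>i. i \<in> J \<Longrightarrow> expectation (Y i) = 0"
    and var: "(\<Sum>i\<in>J. expectation (\<lambda>\<omega>. (Y i \<omega>)\<^sup>2)) = 1"
    and "a \<le> b"
  shows "\<bar>prob {\<omega> \<in> space M. a \<le> (\<Sum>i\<in>J. Y i \<omega>) \<and> (\<Sum>i\<in>J. Y i \<omega>) \<le> b} - (std_normal_cdf b - std_normal_cdf a)\<bar>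
    \<le> 7.4508 * (\<Sum>i\<in>J. expectation (\<lambda>\<omega>. min ((Y i \<omega>)\<^sup>2) (\<bar>Y i \<omega>\<bar> ^ 3)))"
proof -
  define g where "g i = expectation (\<lambda>\<omega>. min ((Y i \<omega>)\<^sup>2) (\<bar>Y i \<omega>\<bar> ^ 3))" for i
  define \<gamma> where "\<gamma> = (\<Sum>i\<in>J. g i)"
  define v where "v i = expectation (\<lambda>\<omega>. (Y i \<omega>)\<^sup>2)" for i
  define W where "W \<omega> = (\<Sum>i\<in>J. Y i \<omega>)" for \<omega>
  define A where "A = {\<omega> \<in> space M. a \<le> W \<omega> \<and> W \<omega> \<le> b}"
  define N where "N = std_normal_cdf b - std_normal_cdf a"
  have rv [measurable]: "random_variable borel (Y i)" if "i \<in> J" for i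
    using indep_vars_rv[OF ind that] .
  have [measurable]: "random_variable borel W" unfolding W_def by measurable
  have [measurable]: "A \<in> events" unfolding A_def by measurable
  have intY: "integrable M (Y i)" if "i \<in> J" for i
    using that by (intro square_integrable_imp_integrable[OF rv sq])
  have intg: "integrable M (\<lambda>\<omega>. min ((Y i \<omega>)\<^sup>2) (\<bar>Y i \<omega>\<bar> ^ 3))" if "i \<in> J" for i
    by (rule Bochner_Integration.integrable_bound[OF sq[OF that]]) (use that in auto)
  have v_nonneg: "0 \<le> v i" and g_nonneg: "0 \<le> g i" for i by (simp_all add: v_def g_def)
  then have \<gamma>_nonneg: "0 \<le> \<gamma>" by (simp add: \<gamma>_def sum_nonneg)
  have v_sum: "(\<Sum>i\<in>J. v i) = 1" using var by (simp add: v_def)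
  have "\<bar>prob A - N\<bar> \<le> 7.4508 * \<gamma>"
  proof (cases "1 \<le> 7.4508 * \<gamma>")
    case True
    have "0 \<le> N" "N \<le> 1" using std_normal_cdf_mono[OF \<open>a \<le> b\<close>] std_normal_cdf_nonneg[of a] std_normal_cdf_le_1[of b]
      by (simp_all add: N_def)
    moreover have "0 \<le> prob A" "prob A \<le> 1" by simp_all
    ultimately have "\<bar>prob A - N\<bar> \<le> 1" by linarith
    with True show ?thesis by linarith
  next
    case False
    \<comment> \<open>If \<gamma> vanished, every Y i would be zero almost surely, against total
      variance 1. Positivity matters because \<gamma> will be the truncation level d of the
      concentration inequality.\<close>
    have "\<gamma> \<noteq> 0"
    proof
      assume "\<gamma> = 0"
      have "v i = 0" if "i \<in> J" for i
      proof -
        have "g i = 0" using \<open>\<gamma> = 0\<close> that fin g_nonneg by (simp add: \<gamma>_def sum_nonneg_eq_0_iff)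
        then have "AE \<omega> in M. min ((Y i \<omega>)\<^sup>2) (\<bar>Y i \<omega>\<bar> ^ 3) = 0"
          unfolding g_def using intg[OF that] by (subst (asm) integral_nonneg_eq_0_iff_AE) auto
        then have "AE \<omega> in M. (Y i \<omega>)\<^sup>2 = 0" by eventually_elim (auto simp: min_def split: if_splits)
        then have "v i = expectation (\<lambda>_. 0)" unfolding v_def using that by (intro integral_cong_AE) auto
        then show ?thesis by simp
      qed
      with v_sum show False by simp
    qed
    with \<gamma>_nonneg have "0 < \<gamma>" by simp
    \<comment> \<open>The reciprocal of 7.4508 is below 0.135.\<close>
    have \<gamma>_le: "\<gamma> \<le> 0.135" using False by simp
    define T where "T i = expectation (\<lambda>\<omega>. \<bar>Y i \<omega>\<bar> * min \<gamma> \<bar>Y i \<omega>\<bar>)" for i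
    have intT: "integrable M (\<lambda>\<omega>. \<bar>Y i \<omega>\<bar> * min \<gamma> \<bar>Y i \<omega>\<bar>)" if "i \<in> J" for i
      using that intY \<open>0 < \<gamma>\<close> by (intro integrable_mult_bounded[where C=\<gamma>]) auto
    \<comment> \<open>With x = |y| \<ge> \<gamma>, the comparison with x^3 amounts to x (x - 2
      \<gamma>)^2 \<ge> 0; the comparison with x^2 follows from 4 \<gamma> \<le> 1. For x < \<gamma>
      nothing is truncated.\<close>
    have T_lower: "v i - g i / (4 * \<gamma>) \<le> T i" if "i \<in> J" for i
    proof -
      have le: "y\<^sup>2 - min (y\<^sup>2) (\<bar>y\<bar> ^ 3) / (4 * \<gamma>) \<le> \<bar>y\<bar> * min \<gamma> \<bar>y\<bar>" for y
      proof -
        define x where "x = \<bar>y\<bar>"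
        have x: "0 \<le> x" "y\<^sup>2 = x\<^sup>2" by (simp_all add: x_def)
        have "4 * \<gamma> * (x\<^sup>2 - x * min \<gamma> x) \<le> min (x\<^sup>2) (x ^ 3)"
        proof -
          have "4 * \<gamma> * (x\<^sup>2 - x * min \<gamma> x) \<le> x\<^sup>2"
          proof -
            have "0 \<le> x * min \<gamma> x" using x \<open>0 < \<gamma>\<close> by simp
            then have "4 * \<gamma> * (x\<^sup>2 - x * min \<gamma> x) \<le> 4 * \<gamma> * x\<^sup>2"
              using \<open>0 < \<gamma>\<close> by (intro mult_left_mono) auto
            also have "\<dots> \<le> 1 * x\<^sup>2" using \<gamma>_le by (intro mult_right_mono) auto
            finally show ?thesis by simp
          qed
          moreover have "4 * \<gamma> * (x\<^sup>2 - x * min \<gamma> x) \<le> x ^ 3"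
          proof (cases "\<gamma> \<le> x")
            case True
            have "0 \<le> x * (x - 2 * \<gamma>)\<^sup>2" using x by simp
            then show ?thesis using True by (simp add: power2_eq_square power3_eq_cube algebra_simps)
          next
            case False
            then show ?thesis using x by (simp add: min_def power2_eq_square)
          qed
          ultimately show ?thesis by simp
        qed
        then have "x\<^sup>2 - x * min \<gamma> x \<le> min (x\<^sup>2) (x ^ 3) / (4 * \<gamma>)"
          using \<open>0 < \<gamma>\<close> by (simp add: pos_le_divide_eq mult.commute)
        then show ?thesis using x by (simp add: x_def[symmetric])
      qed
      have "expectation (\<lambda>\<omega>. (Y i \<omega>)\<^sup>2 - min ((Y i \<omega>)\<^sup>2) (\<bar>Y i \<omega>\<bar> ^ 3) / (4 * \<gamma>)) \<le> T i"
        unfolding T_def using sq[OF that] intg[OF that] intT[OF that] le by (intro integral_mono) auto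
      then show ?thesis using sq[OF that] intg[OF that] by (simp add: v_def g_def)
    qed
    have T_upper: "T i \<le> \<gamma>" if "i \<in> J" for i
    proof -
      have "v i \<le> 1" using member_le_sum[of i J v] that v_nonneg fin v_sum by simp
      then have "expectation (\<lambda>\<omega>. \<bar>Y i \<omega>\<bar>) \<le> 1"
        using rv[OF that] sq[OF that] by (intro expectation_abs_le) (auto simp: v_def)
      moreover have "T i \<le> expectation (\<lambda>\<omega>. \<gamma> * \<bar>Y i \<omega>\<bar>)"
        unfolding T_def using intT[OF that] intY[OF that]
        by (intro integral_mono) (auto simp: mult.commute[of \<gamma>] intro!: mult_left_mono)
      moreover have "expectation (\<lambda>\<omega>. \<gamma> * \<bar>Y i \<omega>\<bar>) = \<gamma> * expectation (\<lambda>\<omega>. \<bar>Y i \<omega>\<bar>)" by simp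
      ultimately show ?thesis using mult_left_le[of "expectation (\<lambda>\<omega>. \<bar>Y i \<omega>\<bar>)" \<gamma>] \<open>0 < \<gamma>\<close> by linarith
    qed
    \<comment> \<open>The value is 1 - \<gamma> / (4 \<gamma>).\<close>
    have T_sum: "3 / 4 \<le> (\<Sum>i\<in>J. T i)"
    proof -
      have "3 / 4 = (\<Sum>i\<in>J. v i - g i / (4 * \<gamma>))"
        using v_sum \<open>0 < \<gamma>\<close> by (simp add: sum_subtractf sum_divide_distrib[symmetric] \<gamma>_def[symmetric])
      also have "\<dots> \<le> (\<Sum>i\<in>J. T i)" by (intro sum_mono T_lower)
      finally show ?thesis .
    qed
    have step: "\<bar>v i * expectation (\<lambda>\<omega>. stein_int_deriv a b (W \<omega>)) - expectation (\<lambda>\<omega>. Y i \<omega> * stein_int a b (W \<omega>))\<bar>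
        \<le> 4.95 * g i + v i * (2.5 * \<gamma>)"
      if i: "i \<in> J" for i
    proof -
      define V where "V \<omega> = (\<Sum>k\<in>J - {i}. Y k \<omega>)" for \<omega>
      have WV: "W \<omega> = V \<omega> + Y i \<omega>" for \<omega>
        using fin i by (simp add: W_def V_def sum.remove[of J i])
      have iV: "indep_var borel (Y i) borel V"
        unfolding V_def by (rule indep_var_sum_others[OF fin ind i])
      have indV: "indep_vars (\<lambda>_. borel) Y (J - {i})" by (rule indep_vars_subset[OF ind]) auto
      have varV: "(\<Sum>k\<in>J - {i}. v k) \<le> 1"
        using v_sum sum.remove[OF fin i, of v] v_nonneg[of i] by simp
      have intV: "integrable M V" unfolding V_def using intY by (intro Bochner_Integration.integrable_sum) auto
      have absV: "expectation (\<lambda>\<omega>. \<bar>V \<omega>\<bar>) \<le> 1"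
      proof (rule expectation_abs_le)
        show "integrable M (\<lambda>\<omega>. (V \<omega>)\<^sup>2)"
          unfolding V_def using fin sq mean by (intro integrable_indep_sum_square[OF _ indV]) auto
        have "expectation (\<lambda>\<omega>. (V \<omega>)\<^sup>2) = (\<Sum>k\<in>J - {i}. v k)"
          unfolding V_def v_def using fin sq mean by (intro expectation_indep_sum_square[OF _ indV]) auto
        with varV show "expectation (\<lambda>\<omega>. (V \<omega>)\<^sup>2) \<le> 1\<^sup>2" by simp
      qed (use intV in auto)
      have conc: "prob {\<omega> \<in> space M. c \<le> V \<omega> \<and> V \<omega> \<le> d} \<le> d - c + 2.5 * \<gamma>" if "c \<le> d" for c d
      proof -
        \<comment> \<open>Removing the index i costs at most \<gamma>, and 0.75 - 0.135 is still
          above 0.6.\<close>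
        have m: "0.6 \<le> (\<Sum>k\<in>J - {i}. T k)"
          using T_sum sum.remove[OF fin i, of T] T_upper[OF i] \<gamma>_le by simp
        \<comment> \<open>After division by 0.6 the coefficient of the length is 1 / 1.2, below 1,
          and the additive term is (1.5 / 0.6) \<gamma> = 2.5 \<gamma>.\<close>
        have "0.6 * prob {\<omega> \<in> space M. c \<le> V \<omega> \<and> V \<omega> \<le> d} \<le> (d - c) / 2 + 3 / 2 * \<gamma>"
          unfolding V_def
          using fin sq mean varV m \<open>0 < \<gamma>\<close> that
          by (intro indep_sum_interval_prob[OF _ indV]) (auto simp: T_def v_def)
        then show ?thesis using that \<open>0 < \<gamma>\<close> by (simp add: field_simps)
      qed
      have "\<bar>expectation (\<lambda>\<omega>. Y i \<omega> * stein_int a b (V \<omega> + Y i \<omega>)) - v i * expectation (\<lambda>\<omega>. stein_int_deriv a b (V \<omega> + Y i \<omega>))\<bar>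
         \<le> expectation (\<lambda>\<omega>. (Y i \<omega>)\<^sup>2 * min 2 (1.65 * \<bar>Y i \<omega>\<bar>))
            + v i * (expectation (\<lambda>\<omega>. min 2 (3.3 * \<bar>Y i \<omega>\<bar>)) + 2.5 * \<gamma>)"
        unfolding v_def using \<open>0 < \<gamma>\<close>
        by (intro stein_summand[OF iV sq[OF i] mean[OF i] intV absV _ conc \<open>a \<le> b\<close>]) auto
      \<comment> \<open>Association merges the product of v i with a mean of min 2 (3.3 |Y i|) into
        one expectation.\<close>
      also have "\<dots> \<le> expectation (\<lambda>\<omega>. (Y i \<omega>)\<^sup>2 * min 2 (1.65 * \<bar>Y i \<omega>\<bar>))
            + expectation (\<lambda>\<omega>. (Y i \<omega>)\<^sup>2 * min 2 (3.3 * \<bar>Y i \<omega>\<bar>)) + v i * (2.5 * \<gamma>)"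
        using expectation_min_association[OF rv[OF i] sq[OF i], of "3.3"] by (simp add: v_def distrib_left)
      also have "\<dots> = expectation (\<lambda>\<omega>. (Y i \<omega>)\<^sup>2 * min 2 (1.65 * \<bar>Y i \<omega>\<bar>)
            + (Y i \<omega>)\<^sup>2 * min 2 (3.3 * \<bar>Y i \<omega>\<bar>)) + v i * (2.5 * \<gamma>)"
        using sq[OF i] rv[OF i]
        by (subst Bochner_Integration.integral_add) (auto intro!: integrable_mult_bounded[where C=2])
      finally have bound: "\<bar>v i * expectation (\<lambda>\<omega>. stein_int_deriv a b (W \<omega>)) - expectation (\<lambda>\<omega>. Y i \<omega> * stein_int a b (W \<omega>))\<bar>
          \<le> expectation (\<lambda>\<omega>. (Y i \<omega>)\<^sup>2 * min 2 (1.65 * \<bar>Y i \<omega>\<bar>) + (Y i \<omega>)\<^sup>2 * min 2 (3.3 * \<bar>Y i \<omega>\<bar>))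
            + v i * (2.5 * \<gamma>)"
        unfolding WV[symmetric] by (subst abs_minus_commute)
      have "expectation (\<lambda>\<omega>. (Y i \<omega>)\<^sup>2 * min 2 (1.65 * \<bar>Y i \<omega>\<bar>) + (Y i \<omega>)\<^sup>2 * min 2 (3.3 * \<bar>Y i \<omega>\<bar>))
          \<le> expectation (\<lambda>\<omega>. 4.95 * min ((Y i \<omega>)\<^sup>2) (\<bar>Y i \<omega>\<bar> ^ 3))"
      proof (rule integral_mono)
        show "y\<^sup>2 * min 2 (1.65 * \<bar>y\<bar>) + y\<^sup>2 * min 2 (3.3 * \<bar>y\<bar>) \<le> 4.95 * min (y\<^sup>2) (\<bar>y\<bar> ^ 3)" for y :: real
        proof -
          \<comment> \<open>The caps give 2 + 2 \<le> 4.95 and the slopes give exactly 1.65 + 3.3 =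
            4.95.\<close>
          have le: "y\<^sup>2 * min 2 (1.65 * \<bar>y\<bar>) \<le> y\<^sup>2 * 2" "y\<^sup>2 * min 2 (3.3 * \<bar>y\<bar>) \<le> y\<^sup>2 * 2"
            "y\<^sup>2 * min 2 (1.65 * \<bar>y\<bar>) \<le> y\<^sup>2 * (1.65 * \<bar>y\<bar>)" "y\<^sup>2 * min 2 (3.3 * \<bar>y\<bar>) \<le> y\<^sup>2 * (3.3 * \<bar>y\<bar>)"
            by (intro mult_left_mono; simp)+
          have "y\<^sup>2 * min 2 (1.65 * \<bar>y\<bar>) + y\<^sup>2 * min 2 (3.3 * \<bar>y\<bar>) \<le> 4.95 * y\<^sup>2"
          proof -
            have "y\<^sup>2 * 2 + y\<^sup>2 * 2 \<le> 4.95 * y\<^sup>2" by simp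
            with le(1,2) show ?thesis by linarith
          qed
          moreover have "y\<^sup>2 * min 2 (1.65 * \<bar>y\<bar>) + y\<^sup>2 * min 2 (3.3 * \<bar>y\<bar>) \<le> 4.95 * \<bar>y\<bar> ^ 3"
          proof -
            have "4.95 * \<bar>y\<bar> ^ 3 = y\<^sup>2 * (1.65 * \<bar>y\<bar>) + y\<^sup>2 * (3.3 * \<bar>y\<bar>)"
              by (simp add: power3_eq_cube power2_eq_square)
            with le(3,4) show ?thesis by linarith
          qed
          ultimately show ?thesis by (simp only: min_def split: if_split) simp
        qed
      qed (use sq[OF i] rv[OF i] intg[OF i] in \<open>auto intro!: integrable_mult_bounded[where C=2] Bochner_Integration.integrable_add\<close>)
      also have "\<dots> = 4.95 * g i" by (simp add: g_def)
      finally show ?thesis using bound by linarith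
    qed
    have intS: "integrable M (\<lambda>\<omega>. Y i \<omega> * stein_int a b (W \<omega>))" if "i \<in> J" for i
      using intY[OF that] abs_stein_int_le by (intro integrable_mult_bounded[where C="1.3"]) auto
    have WS: "(\<Sum>i\<in>J. expectation (\<lambda>\<omega>. Y i \<omega> * stein_int a b (W \<omega>))) = expectation (\<lambda>\<omega>. W \<omega> * stein_int a b (W \<omega>))"
      unfolding W_def[of _, THEN arg_cong[where f="\<lambda>x. x * _"]] sum_distrib_right
      using intS by (subst Bochner_Integration.integral_sum) auto
    \<comment> \<open>The Stein equation is evaluated at W and averaged.\<close>
    have "prob A - N = expectation (\<lambda>\<omega>. stein_int_deriv a b (W \<omega>)) - expectation (\<lambda>\<omega>. W \<omega> * stein_int a b (W \<omega>))"
    proof -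
      have eq: "stein_int_deriv a b (W \<omega>) = W \<omega> * stein_int a b (W \<omega>) + indicator A \<omega> - N" if "\<omega> \<in> space M" for \<omega>
        using that by (auto simp: stein_int_deriv_def A_def N_def indicator_def)
      have i1: "integrable M (\<lambda>\<omega>. W \<omega> * stein_int a b (W \<omega>))"
        using abs_stein_int_mult_le by (intro integrable_const_bound[where B=2]) auto
      have i2: "integrable M (indicator A :: 'a \<Rightarrow> real)" by (simp add: integrable_indicator_iff emeasure_eq_measure)
      have "expectation (\<lambda>\<omega>. stein_int_deriv a b (W \<omega>)) = expectation (\<lambda>\<omega>. W \<omega> * stein_int a b (W \<omega>) + indicator A \<omega> - N)"
        by (rule Bochner_Integration.integral_cong[OF refl eq])
      also have "\<dots> = expectation (\<lambda>\<omega>. W \<omega> * stein_int a b (W \<omega>)) + prob A - N"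
        using i1 i2 by (simp add: prob_space)
      finally show ?thesis by simp
    qed
    \<comment> \<open>As the v i sum to 1, the mean derivative is distributed over the summands with
      weights v i.\<close>
    also have "\<dots> = (\<Sum>i\<in>J. v i * expectation (\<lambda>\<omega>. stein_int_deriv a b (W \<omega>)) - expectation (\<lambda>\<omega>. Y i \<omega> * stein_int a b (W \<omega>)))"
      by (simp add: sum_subtractf sum_distrib_right[symmetric] v_sum WS)
    also have "\<bar>\<dots>\<bar> \<le> (\<Sum>i\<in>J. 4.95 * g i + v i * (2.5 * \<gamma>))"
      by (rule order_trans[OF sum_abs sum_mono[OF step]])
    also have "\<dots> = 4.95 * \<gamma> + 2.5 * \<gamma>"
      by (simp only: sum.distrib sum_distrib_left[symmetric] sum_distrib_right[symmetric] v_sum \<gamma>_def[symmetric])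
    finally show ?thesis using \<open>0 < \<gamma>\<close> by simp
  qed
  then show ?thesis by (simp add: A_def W_def N_def \<gamma>_def g_def)
qed

section \<open>From interval probabilities to concentration functions\<close>

lemma concentration_fun_normal_approx:
  assumes [measurable]: "random_variable borel S" and "0 < B" and "0 \<le> z"
    and approx: "\<And>a b. a \<le> b \<Longrightarrow> \<bar>prob {\<omega> \<in> space M. a * B \<le> S \<omega> \<and> S \<omega> \<le> b * B} - (std_normal_cdf b - std_normal_cdf a)\<bar> \<le> C"
  shows "\<bar>concentration_fun M S z - folded_normal_cdf (z / (2 * B))\<bar> \<le> C"
proof -
  let ?P = "\<lambda>x. prob {\<omega> \<in> space M. x \<le> S \<omega> \<and> S \<omega> \<le> x + z}"
  define d where "d = z / B"
  have d: "0 \<le> d" "d * B = z" using assms(2,3) by (simp_all add: d_def)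
  have fold: "folded_normal_cdf (z / (2 * B)) = 2 * std_normal_cdf (d / 2) - 1"
    using assms(2,3) by (simp add: folded_normal_cdf_def d_def mult.commute)
  have P: "\<bar>?P (u * B) - (std_normal_cdf (u + d) - std_normal_cdf u)\<bar> \<le> C" for u
    using approx[of u "u + d"] d by (simp add: distrib_right)
  \<comment> \<open>Among intervals of length d the centred one has the largest normal probability,
    so the bound is uniform in x.\<close>
  have "concentration_fun M S z \<le> 2 * std_normal_cdf (d / 2) - 1 + C"
    unfolding concentration_fun_def
  proof (rule cSUP_least)
    fix x
    show "?P x \<le> 2 * std_normal_cdf (d / 2) - 1 + C"
      using P[of "x / B"] std_normal_cdf_interval_le[OF d(1), of "x / B"] \<open>0 < B\<close> by (simp add: abs_le_iff)
  qed simp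
  moreover have "2 * std_normal_cdf (d / 2) - 1 - C \<le> concentration_fun M S z"
  proof -
    \<comment> \<open>The choice x = -z / 2 gives the centred interval, whose normal probability is
      exactly the folded value.\<close>
    have "2 * std_normal_cdf (d / 2) - 1 - C \<le> ?P (- d / 2 * B)"
      using P[of "- d / 2"] std_normal_cdf_minus[of "d / 2"] by (simp add: abs_le_iff)
    also have "\<dots> \<le> concentration_fun M S z"
      unfolding concentration_fun_def by (rule cSUP_upper[OF UNIV_I bdd_above_concentration_fun])
    finally show ?thesis .
  qed
  ultimately show ?thesis unfolding fold by (simp add: abs_le_iff)
qed

end

section \<open>Normalisation and comparison with the truncated moments\<close>

theorem theorem1:
  fixes M :: "'a measure" and X :: "nat \<Rightarrow> 'a \<Rightarrow> real" and \<sigma> :: "nat \<Rightarrow> real"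
    and n :: nat and \<epsilon> :: real
  assumes "prob_space M"
    and "prob_space.indep_vars M (\<lambda>_. borel) X {1..}"
    and "\<And>i. i \<ge> 1 \<Longrightarrow> integrable M (X i)"
    and "\<And>i. i \<ge> 1 \<Longrightarrow> (\<integral>\<omega>. X i \<omega> \<partial>M) = 0"
    and "\<And>i. i \<ge> 1 \<Longrightarrow> integrable M (\<lambda>\<omega>. (X i \<omega>)\<^sup>2)"
    and "\<And>i. i \<ge> 1 \<Longrightarrow> (\<integral>\<omega>. (X i \<omega>)\<^sup>2 \<partial>M) = (\<sigma> i)\<^sup>2"
    and "\<And>i. i \<ge> 1 \<Longrightarrow> 0 < (\<sigma> i)\<^sup>2"
    and "n \<ge> 1"
    and "\<epsilon> > 0"
  shows "(SUP z\<in>{0..}. \<bar>concentration_fun M (partial_sum X n) z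
                       - folded_normal_cdf (z / (2 * B_norm \<sigma> n))\<bar>)
           \<le> 7.4508 * (L_frac M X \<sigma> n \<epsilon> + M_frac M X \<sigma> n \<epsilon>)"
proof -
  interpret prob_space M by fact
  define B where "B = B_norm \<sigma> n"
  define Y where "Y i \<omega> = X i \<omega> / B" for i \<omega>
  have sum_pos: "0 < (\<Sum>i=1..n. (\<sigma> i)\<^sup>2)" using assms(7,8) by (intro sum_pos) auto
  then have "0 < B" and B2: "B\<^sup>2 = (\<Sum>i=1..n. (\<sigma> i)\<^sup>2)"
    by (simp_all add: B_def B_norm_def)
  have rvX [measurable]: "random_variable borel (X i)" if "i \<in> {1..n}" for i
    using indep_vars_rv[OF assms(2), of i] that by simp
  have ind: "indep_vars (\<lambda>_. borel) Y {1..n}"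
    unfolding Y_def
    by (rule indep_vars_compose2[OF indep_vars_subset[OF assms(2)], where Y="\<lambda>_ x. x / B"]) auto
  have sq: "integrable M (\<lambda>\<omega>. (Y i \<omega>)\<^sup>2)" and mean: "expectation (Y i) = 0"
    and EY: "expectation (\<lambda>\<omega>. (Y i \<omega>)\<^sup>2) = (\<sigma> i)\<^sup>2 / B\<^sup>2" if "i \<in> {1..n}" for i
    using assms(4,5,6)[of i] that by (simp_all add: Y_def[abs_def] power_divide)
  have var: "(\<Sum>i=1..n. expectation (\<lambda>\<omega>. (Y i \<omega>)\<^sup>2)) = 1"
    using EY sum_pos by (simp add: sum_divide_distrib[symmetric] B2)
  define C where "C = 7.4508 * (\<Sum>i=1..n. expectation (\<lambda>\<omega>. min ((Y i \<omega>)\<^sup>2) (\<bar>Y i \<omega>\<bar> ^ 3)))"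
  have S: "partial_sum X n \<omega> = (\<Sum>i=1..n. Y i \<omega>) * B" for \<omega>
    using \<open>0 < B\<close> by (simp add: partial_sum_def Y_def sum_divide_distrib[symmetric])
  have [measurable]: "random_variable borel (partial_sum X n)"
    unfolding partial_sum_def[abs_def] by measurable
  have "\<bar>concentration_fun M (partial_sum X n) z - folded_normal_cdf (z / (2 * B))\<bar> \<le> C" if "0 \<le> z" for z
  proof (rule concentration_fun_normal_approx[OF _ \<open>0 < B\<close> that])
    fix a b :: real assume "a \<le> b"
    from indep_sum_normal_approx[OF finite_atLeastAtMost ind sq mean var this] \<open>0 < B\<close>
    show "\<bar>prob {\<omega> \<in> space M. a * B \<le> partial_sum X n \<omega> \<and> partial_sum X n \<omega> \<le> b * B}
        - (std_normal_cdf b - std_normal_cdf a)\<bar> \<le> C"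
      by (simp add: S C_def)
  qed measurable
  then have "(SUP z\<in>{0..}. \<bar>concentration_fun M (partial_sum X n) z - folded_normal_cdf (z / (2 * B))\<bar>) \<le> C"
    by (intro cSUP_least) auto
  also have "C \<le> 7.4508 * (L_frac M X \<sigma> n \<epsilon> + M_frac M X \<sigma> n \<epsilon>)"
  proof -
    define l where "l i \<omega> = (X i \<omega>)\<^sup>2 * indicator {\<omega>. \<bar>X i \<omega>\<bar> \<ge> \<epsilon> * B} \<omega>" for i \<omega>
    define m where "m i \<omega> = \<bar>X i \<omega>\<bar> ^ 3 * indicator {\<omega>. \<bar>X i \<omega>\<bar> < \<epsilon> * B} \<omega>" for i \<omega>
    have "expectation (\<lambda>\<omega>. min ((Y i \<omega>)\<^sup>2) (\<bar>Y i \<omega>\<bar> ^ 3)) \<le> 1 / B\<^sup>2 * expectation (l i) + 1 / B ^ 3 * expectation (m i)"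
      if i: "i \<in> {1..n}" for i
    proof -
      have l': "l i \<omega> = (X i \<omega>)\<^sup>2 * (if \<bar>X i \<omega>\<bar> \<ge> \<epsilon> * B then 1 else 0)" for \<omega>
        by (simp add: l_def)
      \<comment> \<open>Third moments are not assumed; the truncated cube is integrable because it
        is X^2 times a factor bounded by \<epsilon> B.\<close>
      have m': "m i \<omega> = (X i \<omega>)\<^sup>2 * (if \<bar>X i \<omega>\<bar> < \<epsilon> * B then \<bar>X i \<omega>\<bar> else 0)" for \<omega>
        by (simp add: m_def power2_eq_square power3_eq_cube)
      have sqX: "integrable M (\<lambda>\<omega>. (X i \<omega>)\<^sup>2)" using assms(5) i by simp
      have [measurable]: "random_variable borel (X i)" by (rule rvX[OF i])
      have intl: "integrable M (l i)" unfolding l'[abs_def]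
        by (rule integrable_mult_bounded[OF sqX, where C=1]) auto
      have intm: "integrable M (m i)" unfolding m'[abs_def]
        using \<open>0 < B\<close> \<open>\<epsilon> > 0\<close> by (intro integrable_mult_bounded[OF sqX, where C="\<epsilon> * B"]) auto
      have "expectation (\<lambda>\<omega>. min ((Y i \<omega>)\<^sup>2) (\<bar>Y i \<omega>\<bar> ^ 3)) \<le> expectation (\<lambda>\<omega>. 1 / B\<^sup>2 * l i \<omega> + 1 / B ^ 3 * m i \<omega>)"
      proof (rule integral_mono)
        show "integrable M (\<lambda>\<omega>. min ((Y i \<omega>)\<^sup>2) (\<bar>Y i \<omega>\<bar> ^ 3))"
          by (rule Bochner_Integration.integrable_bound[OF sq[OF i]]) (auto simp: Y_def[abs_def])
        \<comment> \<open>The minimum is replaced by the square where |X i| \<ge> \<epsilon> B and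
          by the cube elsewhere, which works for any truncation level.\<close>
        show "min ((Y i \<omega>)\<^sup>2) (\<bar>Y i \<omega>\<bar> ^ 3) \<le> 1 / B\<^sup>2 * l i \<omega> + 1 / B ^ 3 * m i \<omega>" for \<omega>
          using \<open>0 < B\<close> by (cases "\<bar>X i \<omega>\<bar> < \<epsilon> * B") (simp_all add: l_def m_def Y_def power_divide)
      qed (use intl intm in auto)
      also have "\<dots> = 1 / B\<^sup>2 * expectation (l i) + 1 / B ^ 3 * expectation (m i)"
        using intl intm by simp
      finally show ?thesis .
    qed
    then have "(\<Sum>i=1..n. expectation (\<lambda>\<omega>. min ((Y i \<omega>)\<^sup>2) (\<bar>Y i \<omega>\<bar> ^ 3)))
        \<le> (\<Sum>i=1..n. 1 / B\<^sup>2 * expectation (l i) + 1 / B ^ 3 * expectation (m i))"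
      by (rule sum_mono)
    also have "\<dots> = L_frac M X \<sigma> n \<epsilon> + M_frac M X \<sigma> n \<epsilon>"
      unfolding L_frac_def M_frac_def B_def[symmetric] l_def[abs_def] m_def[abs_def]
      by (simp only: sum.distrib sum_distrib_left)
    finally show ?thesis by (simp add: C_def)
  qed
  finally show ?thesis by (simp add: B_def)
qed

end
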